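(* Let $\mathcal X_0\in\mathrm{Gr}(n,k)$ satisfy $\mathrm{dist}(\mathcal X_0,\mathcal V_\alpha)<\pi/2$. Let $\eta>0$ and let $(\eta_t)_{t\ge 0}$ be step sizes such that for all $t\ge 0$ $$0<\eta\le \eta_t\le \frac{\cos(\mathrm{dist}(\mathcal X_0,\mathcal V_\alpha))}{\gamma}.$$ Then the iterates of Riemannian steepest descent $\mathcal X_{t+1}=\mathrm{Exp}_{\mathcal X_t}(-\eta_t\,\mathrm{grad} f(\mathcal X_t))$ satisfy, for all $t\ge 0$, $$\mathrm{dist}^2(\mathcal X_t,\mathcal V_\alpha)\le \bigl(1-2c_Q\cos(\mathrm{dist}(\mathcal X_0,\mathcal V_\alpha))\,\delta\,\eta\bigr)^t\,\mathrm{dist}^2(\mathcal X_0,\mathcal V_\alpha),\qquad c_Q=\frac{4}{\pi^2}.$$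
   Context: Let $1\le k\le n-1$ and let $A\in\mathbb R^{n\times n}$ be symmetric positive semidefinite with eigenvalues $\lambda_1\ge\cdots\ge\lambda_n$ (with multiplicity) and orthonormal eigenvectors $v_1,\dots,v_n$, $Av_i=\lambda_iv_i$. Put $\delta=\lambda_k-\lambda_{k+1}\ge 0$, $\gamma=2(\lambda_1-\lambda_n)$ and $\mathcal V_\alpha=\mathrm{span}(v_1,\dots,v_k)$ (if $\delta=0$, $\mathcal V_\alpha$ is any fixed subspace spanned by $k$ leading eigenvectors). If $\gamma=0$, an upper bound of the form $c/\gamma$ on a step size is regarded as no constraint. $\mathrm{Gr}(n,k)$ is the Grassmann manifold of $k$-dimensional subspaces of $\mathbb R^n$; a subspace $\mathcal X=\mathrm{span}(X)$ is always represented by $X\in\mathbb R^{n\times k}$ with $X^TX=I_k$. Tangent vectors at $\mathcal X$ (for a given representative $X$) are the $G\in\mathbb R^{n\times k}$ with $X^TG=0$; the Riemannian metric is $\langle G_1,G_2\rangle=\mathrm{Tr}(G_1^TG_2)$ with norm $\|\cdot\|$ the Frobenius norm. Exponential map: $\mathrm{Exp}_{\mathcal X}(G)=\mathrm{span}(XV\cos(\Sigma)+U\sin(\Sigma))$, where $G=U\Sigma V^T$ is a compact SVD with $\Sigma,V\in\mathbb R^{k\times k}$. The principal angles $0\le\theta_1\le\cdots\le\theta_k\le\pi/2$ between $\mathcal X=\mathrm{span}(X)$ and $\mathcal Y=\mathrm{span}(Y)$ are such that $\cos\theta_1,\dots,\cos\theta_k$ are the singular values of $Y^TX$; the Riemannian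 distance is $\mathrm{dist}(\mathcal X,\mathcal Y)=\sqrt{\theta_1^2+\cdots+\theta_k^2}$. The objective is $f:\mathrm{Gr}(n,k)\to\mathbb R$, $f(\mathcal X)=-\mathrm{Tr}(X^TAX)$, with Riemannian gradient $\mathrm{grad}f(\mathcal X)=-2(I-XX^T)AX$. *)

theory Defs
  imports "HOL-Analysis.Analysis"
begin

(* Matrices in R^(n x k) have type real^'k^'n, so the dimensions are n = CARD('n) and
   k = CARD('k).  A subspace of R^n does not determine the type 'k; hence the itself arguments. *)

definition Gr :: "'k::finite itself \<Rightarrow> (real^'n) set set" where
  "Gr _ = {S. subspace S \<and> dim S = CARD('k)}"

definition represents :: "real^'k^'n \<Rightarrow> (real^'n) set \<Rightarrow> bool" where
  "represents X S \<longleftrightarrow> transpose X ** X = mat 1 \<and> span (columns X) = S"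

definition diag :: "real^'k \<Rightarrow> real^'k^'k" where
  "diag s = (\<chi> i j. if i = j then s $ i else 0)"

(* G = U diag(s) V^T with U having orthonormal columns and V orthogonal.  The order of the
   singular values is left open, as the index type 'k is unordered. *)
definition compact_svd :: "real^'k^'n \<Rightarrow> real^'k^'n \<Rightarrow> real^'k \<Rightarrow> real^'k^'k \<Rightarrow> bool" where
  "compact_svd G U s V \<longleftrightarrow>
     transpose U ** U = mat 1 \<and> orthogonal_matrix V \<and> (\<forall>i. 0 \<le> s $ i) \<and>
     G = U ** diag s ** transpose V"

(* The span does not depend on the chosen decomposition when G is tangent at span X,
   i.e. when X^T G = 0. *)
definition gr_exp :: "real^'k^'n \<Rightarrow> real^'k^'n \<Rightarrow> (real^'n) set" where
  "gr_exp X G = (SOME S. \<exists>U s V. compact_svd G U s V \<and>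
     S = span (columns (X ** V ** diag (\<chi> i. cos (s $ i)) + U ** diag (\<chi> i. sin (s $ i)))))"

definition principal_angles :: "real^'k^'n \<Rightarrow> real^'k^'n \<Rightarrow> real list \<Rightarrow> bool" where
  "principal_angles X Y \<theta>s \<longleftrightarrow>
     sorted \<theta>s \<and> set \<theta>s \<subseteq> {0..pi/2} \<and>
     (\<exists>U s V. compact_svd (transpose Y ** X) U s V \<and>
        mset (map cos \<theta>s) = image_mset (\<lambda>i. s $ i) (mset_set UNIV))"

(* The value does not depend on the representatives, as singular values are unique and
   invariant under orthogonal changes of basis. *)
definition gr_dist :: "'k::finite itself \<Rightarrow> (real^'n) set \<Rightarrow> (real^'n) set \<Rightarrow> real" where
  "gr_dist _ S T = (SOME d. \<exists>(X :: real^'k^'n) Y \<theta>s. represents X S \<and> represents Y T \<and>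
     principal_angles X Y \<theta>s \<and> d = sqrt (\<Sum>\<theta>\<leftarrow>\<theta>s. \<theta>\<^sup>2))"

definition cost :: "real^'n^'n \<Rightarrow> real^'k^'n \<Rightarrow> real" where
  "cost A X = - trace (transpose X ** A ** X)"

definition rgrad :: "real^'n^'n \<Rightarrow> real^'k^'n \<Rightarrow> real^'k^'n" where
  "rgrad A X = (-2) *\<^sub>R ((mat 1 - X ** transpose X) ** A ** X)"

lemma matrix_mult_diff_right: "A ** (B - C) = A ** B - A ** C"
  for A :: "real^'m^'n" and B C :: "real^'k^'m"
  by (simp add: vec_eq_iff matrix_matrix_mult_def right_diff_distrib sum_subtractf)

lemma matrix_mult_diff_left: "(B - C) ** A = B ** A - C ** A"
  for A :: "real^'k^'m" and B C :: "real^'m^'n"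
  by (simp add: vec_eq_iff matrix_matrix_mult_def left_diff_distrib sum_subtractf)

lemma matrix_mult_scaleR_right: "A ** (c *\<^sub>R B) = c *\<^sub>R (A ** B)"
  for A :: "real^'m^'n" and B :: "real^'k^'m"
  by (simp add: vec_eq_iff matrix_matrix_mult_def sum_distrib_left mult.left_commute)

lemma inner_matrix_trace: "inner G1 G2 = trace (transpose G1 ** G2)"
  for G1 G2 :: "real^'k^'n"
proof -
  have "inner G1 G2 = (\<Sum>i\<in>UNIV. \<Sum>j\<in>UNIV. G1 $ i $ j * G2 $ i $ j)"
    by (simp add: inner_vec_def)
  also have "\<dots> = (\<Sum>j\<in>UNIV. \<Sum>i\<in>UNIV. G1 $ i $ j * G2 $ i $ j)"
    by (rule sum.swap)
  finally show ?thesis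
    by (simp add: trace_def matrix_matrix_mult_def transpose_def)
qed

lemma inner_matrix_mult_left: "inner (A ** G) H = inner G (transpose A ** H)"
  for A :: "real^'m^'n" and G :: "real^'k^'m"
  by (simp add: inner_matrix_trace matrix_transpose_mul matrix_mul_assoc)

lemma rgrad_tangent:
  fixes X :: "real^'k^'n"
  assumes "transpose X ** X = mat 1"
  shows "transpose X ** rgrad A X = 0"
proof -
  have "transpose X ** (mat 1 - X ** transpose X) = 0"
    using assms by (simp add: matrix_mult_diff_right matrix_mul_assoc)
  then show ?thesis
    unfolding rgrad_def matrix_mult_scaleR_right matrix_mul_assoc
    by (simp add: vec_eq_iff matrix_matrix_mult_def)
qed

(* rgrad A is the Riemannian gradient of cost A with respect to the trace metric. *)
lemma rgrad_gradient:
  fixes Z :: "real \<Rightarrow> real^'k^'n"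
  assumes sym: "transpose A = A"
    and Z: "(Z has_vector_derivative H) (at 0)"
    and tan: "transpose (Z 0) ** H = 0"
  shows "((\<lambda>s. cost A (Z s)) has_real_derivative inner (rgrad A (Z 0)) H) (at 0)"
proof -
  let ?X = "Z 0"
  have cost_eq: "cost A Y = - inner Y (A ** Y)" for Y :: "real^'k^'n"
    by (simp add: cost_def inner_matrix_trace matrix_mul_assoc)
  have "linear (\<lambda>Y :: real^'k^'n. A ** Y)"
    by (rule linearI) (simp_all add: matrix_add_ldistrib matrix_mult_scaleR_right)
  then have "bounded_linear (\<lambda>Y :: real^'k^'n. A ** Y)"
    by (rule linear_conv_bounded_linear[THEN iffD1])
  from bounded_linear.has_vector_derivative[OF this Z]
  have AZ: "((\<lambda>s. A ** Z s) has_vector_derivative A ** H) (at 0)" .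
  have "((\<lambda>s. cost A (Z s)) has_vector_derivative
      - (inner ?X (A ** H) + inner H (A ** ?X))) (at 0)"
    unfolding cost_eq
    by (intro has_vector_derivative_minus
        bounded_bilinear.has_vector_derivative[OF bounded_bilinear_inner Z AZ])
  moreover have "inner ?X (A ** H) = inner (A ** ?X) H"
    by (simp add: inner_matrix_mult_left sym)
  moreover have "inner (rgrad A ?X) H = - 2 * inner (A ** ?X) H"
  proof -
    have "rgrad A ?X = (-2) *\<^sub>R (A ** ?X - ?X ** (transpose ?X ** A ** ?X))"
      by (simp add: rgrad_def matrix_mult_diff_left matrix_mul_assoc)
    moreover have "inner (?X ** (transpose ?X ** A ** ?X)) H = 0"
      using tan by (simp add: inner_matrix_mult_left)
    ultimately show ?thesis
      by (simp add: inner_diff_left)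
  qed
  ultimately show ?thesis
    by (simp add: has_real_derivative_iff_has_vector_derivative inner_commute)
qed

end

theory Submission
  imports Defs
begin

text \<open>
  Let \<open>\<theta>\<^sub>i\<close> be the principal angles between the iterate and the leading eigenspace, so that the
  squared distance is \<open>\<Sum> \<theta>\<^sub>i\<^sup>2\<close>, and let \<open>d\<close> be the initial distance. One step of length \<open>\<eta>\<close> shrinks the
  squared distance by the claimed factor because of three facts about the suboptimality
  \<open>\<Delta> = cost A X - cost A V\<close>.
  
  \<^item> Growth: \<open>\<Delta> \<ge> \<delta> \<Sum> sin\<^sup>2 \<theta>\<^sub>i\<close> (\<open>energy_gap_ge\<close>).
  \<^item> Direction: the inner product of the gradient with the direction away from the target is at
    least \<open>2 d cot d \<Delta>\<close> (\<open>inner_tangent_part\<close>).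
  \<^item> Smoothness: the squared norm of the gradient is at most \<open>2 \<gamma> \<Delta>\<close> (\<open>norm_tangent_part\<close>).
  
  What remains is a bound for the squared distance after the step by the squared distance before,
  twice the inner product above, and a multiple of the squared step length. By Toponogov's
  comparison theorem such a bound holds with the multiple 1, as the Grassmannian has nonnegative
  curvature. The following elementary argument gives it with a larger multiple. The squared distance is \<open>\<Sum> arccos\<^sup>2 (s\<^sub>i)\<close>, with \<open>s\<^sub>i\<close> the singular values of \<open>V\<^sup>T Y\<close>
  for representatives \<open>V\<close> of the target and \<open>Y\<close> of the new point. Before the step this matrix
  is the diagonal matrix of the cosines of the principal angles, if the representatives are chosen
  well. The function \<open>arccos\<^sup>2\<close> is decreasing and, away from \<open>-1\<close>, lies below its tangents plus
  a quadratic term (\<open>squared_arccos_le_quadratic\<close>). Such a bound passes from scalars to singular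
  values by averaging with doubly stochastic weights (\<open>singular_value_sum_majorant\<close>), and expanding
  \<open>V\<^sup>T Y\<close> along the geodesic gives the estimate \<open>squared_distance_after_step\<close>.
  
  A multiple larger than 1 is affordable: passing from \<open>sin\<^sup>2 \<theta>\<^sub>i\<close> to \<open>\<theta>\<^sub>i\<^sup>2\<close> with the constant
  \<open>4/\<pi>\<^sup>2\<close> is wasteful unless an angle is near \<open>\<pi>/2\<close>, whereas for angles near \<open>\<pi>/2\<close> the factor \<open>d cot d\<close>
  exceeds the \<open>cos d\<close> in the rate by a factor of almost \<open>\<pi>/2\<close>. The inequality \<open>step_budget\<close> makes this trade-off
  precise and \<open>squared_distance_contracts\<close> collects the estimates for one step. Since the distance
  never increases, the bound in terms of the initial distance can be iterated.
\<close>

section \<open>Inequalities between an angle and its cosine\<close>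

lemma one_minus_cos_le: "1 - cos x \<le> x\<^sup>2 / 2" for x :: real
proof -
  have "1 - cos x = 2 * (sin (x/2))\<^sup>2" using cos_double_sin[of "x/2"] by simp
  also have "(sin (x/2))\<^sup>2 \<le> (x/2)\<^sup>2"
    using abs_sin_x_le_abs_x[of "x/2"] by (simp only: abs_le_square_iff)
  finally show ?thesis by (simp add: power_divide)
qed

lemma minus_sin_bounds:
  fixes x :: real
  assumes "0 \<le> x" 
  shows "0 \<le> x - sin x" "x - sin x \<le> x ^ 3 / 6"
proof -
  show "0 \<le> x - sin x" using sin_x_le_x[OF assms] by simp
  have "\<bar>sin x - (\<Sum>m<3. sin_coeff m * x ^ m)\<bar> \<le> inverse (fact 3) * \<bar>x\<bar> ^ 3"
    by (rule Maclaurin_sin_bound)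
  moreover have "(\<Sum>m<3. sin_coeff m * x ^ m) = x"
    by (simp add: numeral_3_eq_3 sin_coeff_def)
  ultimately have "\<bar>sin x - x\<bar> \<le> x ^ 3 / 6" using assms by (simp add: fact_numeral)
  then show "x - sin x \<le> x ^ 3 / 6" by linarith
qed

text \<open>
  The function \<open>\<theta> / sin \<theta>\<close>, continuously extended to 0. It governs both first-order
  quantities of the proof: the derivative of \<open>arccos\<^sup>2\<close> at \<open>cos \<theta>\<close> is \<open>-2 \<theta> / sin \<theta>\<close>, and
  rescaling the normal component of a principal vector (of length \<open>sin \<theta>\<close>) by this factor
  gives the Riemannian logarithm (of length \<open>\<theta>\<close>).
\<close>

definition angle_ratio :: "real \<Rightarrow> real" where
  "angle_ratio t = (if t = 0 then 1 else t / sin t)"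

lemma angle_ratio_times_sin:
  assumes "0 \<le> t" "t \<le> pi/2"
  shows "angle_ratio t * sin t = t"
proof (cases "t = 0")
  case False
  then have "sin t > 0" using assms by (intro sin_gt_zero) auto
  then show ?thesis by (simp add: angle_ratio_def)
qed (simp add: angle_ratio_def)

lemma nonneg_on_quadrant_by_deriv:
  fixes f f' :: "real \<Rightarrow> real"
  assumes d: "\<And>t. (f has_real_derivative f' t) (at t)"
    and pos: "\<And>t. 0 \<le> t \<Longrightarrow> t \<le> pi/2 \<Longrightarrow> 0 \<le> f' t"
    and f0: "f 0 = 0" and t: "0 \<le> t" "t \<le> pi/2"
  shows "0 \<le> f t"
proof -
  have "f 0 \<le> f t"
  proof (rule DERIV_nonneg_imp_nondecreasing[OF t(1)])
    fix x assume "0 \<le> x" "x \<le> t"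
    then show "\<exists>y. (f has_real_derivative y) (at x) \<and> 0 \<le> y"
      using d pos t by (intro exI[of _ "f' x"]) auto
  qed
  then show ?thesis using f0 by simp
qed

lemma cos_in_unit: 
  assumes "0 \<le> t" "t \<le> pi/2" shows "0 \<le> cos t" "cos t \<le> 1"
  using assms by (auto intro: cos_ge_zero)

text \<open>
  Bounds of the form \<open>sin \<theta> \<cdot> r(cos \<theta>)\<close> with a polynomial \<open>r\<close> suit the angle because the
  derivative of the difference is again a polynomial in \<open>cos \<theta>\<close>. The coefficients of the next
  three bounds are chosen such that this polynomial is visibly nonnegative on \<open>[0, 1]\<close>.
\<close>

lemma cubic_bound_below_angle:
  assumes t: "0 \<le> t" "t \<le> pi/2"
  shows "sin t * (6/5 + 2/5 * cos t - 6/5 * cos t ^ 2 + 3/5 * cos t ^ 3) \<le> t"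
proof -
  have "0 \<le> t - sin t * (6/5 + 2/5 * cos t - 6/5 * cos t ^ 2 + 3/5 * cos t ^ 3)"
  proof (rule nonneg_on_quadrant_by_deriv[where f' = "\<lambda>t. (1 - cos t ^ 2) * (7/5 - 18/5 * cos t + 12/5 * cos t ^ 2)", OF _ _ _ t])
    fix t :: real
    have s2: "sin t * sin t = 1 - cos t ^ 2" by (metis power2_eq_square sin_squared_eq)
    have e: "1 - (cos t * (6/5 + 2/5 * cos t - 6/5 * cos t ^ 2 + 3/5 * cos t ^ 3)
        - sin t * sin t * (2/5 - 12/5 * cos t + 9/5 * cos t ^ 2))
        = (1 - cos t ^ 2) * (7/5 - 18/5 * cos t + 12/5 * cos t ^ 2)"
      unfolding s2 by (simp add: field_simps power2_eq_square power3_eq_cube)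
    show "((\<lambda>t. t - sin t * (6/5 + 2/5 * cos t - 6/5 * cos t ^ 2 + 3/5 * cos t ^ 3))
      has_real_derivative (1 - cos t ^ 2) * (7/5 - 18/5 * cos t + 12/5 * cos t ^ 2)) (at t)"
      unfolding e[symmetric]
      by (auto intro!: derivative_eq_intros simp: field_simps power2_eq_square power3_eq_cube)
  next
    fix t :: real assume "0 \<le> t" "t \<le> pi/2"
    have "7/5 - 18/5 * cos t + 12/5 * cos t ^ 2 = 12/5 * (cos t - 3/4)^2 + 1/20"
      by (simp add: power2_eq_square algebra_simps)
    then show "0 \<le> (1 - cos t ^ 2) * (7/5 - 18/5 * cos t + 12/5 * cos t ^ 2)"
      by (intro mult_nonneg_nonneg) (auto simp: abs_square_le_1)
  qed simp
  then show ?thesis by simp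
qed

lemma angle_le_cubic_bound:
  assumes t: "0 \<le> t" "t \<le> pi/2"
  shows "t \<le> sin t * (8/5 - cos t + 3/5 * cos t ^ 2 - 1/5 * cos t ^ 3)"
proof -
  have "0 \<le> sin t * (8/5 - cos t + 3/5 * cos t ^ 2 - 1/5 * cos t ^ 3) - t"
  proof (rule nonneg_on_quadrant_by_deriv[where f' = "\<lambda>t. cos t * (1 - cos t) * (2/5 - cos t + 4/5 * cos t ^ 2)", OF _ _ _ t])
    fix t :: real
    have s2: "sin t * sin t = 1 - cos t ^ 2" by (metis power2_eq_square sin_squared_eq)
    have e: "cos t * (8/5 - cos t + 3/5 * cos t ^ 2 - 1/5 * cos t ^ 3)
        + sin t * sin t * (1 - 6/5 * cos t + 3/5 * cos t ^ 2) - 1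
        = cos t * (1 - cos t) * (2/5 - cos t + 4/5 * cos t ^ 2)"
      unfolding s2 by (simp add: field_simps power2_eq_square power3_eq_cube)
    show "((\<lambda>t. sin t * (8/5 - cos t + 3/5 * cos t ^ 2 - 1/5 * cos t ^ 3) - t)
      has_real_derivative cos t * (1 - cos t) * (2/5 - cos t + 4/5 * cos t ^ 2)) (at t)"
      unfolding e[symmetric]
      by (auto intro!: derivative_eq_intros simp: field_simps power2_eq_square power3_eq_cube)
  next
    fix t :: real assume "0 \<le> t" "t \<le> pi/2"
    moreover have "2/5 - cos t + 4/5 * cos t ^ 2 = 4/5 * (cos t - 5/8)^2 + 7/80"
      by (simp add: power2_eq_square algebra_simps)
    ultimately show "0 \<le> cos t * (1 - cos t) * (2/5 - cos t + 4/5 * cos t ^ 2)"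
      using cos_in_unit[of t] by (intro mult_nonneg_nonneg) auto
  qed simp
  then show ?thesis by simp
qed

lemma quadratic_bound_below_angle:
  assumes t: "0 \<le> t" "t \<le> pi/2"
  shows "sin t * (22/15 - 3/5 * cos t + 2/15 * cos t ^ 2) \<le> t"
proof -
  have "0 \<le> t - sin t * (22/15 - 3/5 * cos t + 2/15 * cos t ^ 2)"
  proof (rule nonneg_on_quadrant_by_deriv[where f' = "\<lambda>t. 2/5 * (1 - cos t) ^ 3", OF _ _ _ t])
    fix t :: real
    have s2: "sin t * sin t = 1 - cos t ^ 2" by (metis power2_eq_square sin_squared_eq)
    have e: "1 - (cos t * (22/15 - 3/5 * cos t + 2/15 * cos t ^ 2)
        + sin t * sin t * (3/5 - 4/15 * cos t)) = 2/5 * (1 - cos t) ^ 3"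
      unfolding s2 by (simp add: field_simps power2_eq_square power3_eq_cube)
    show "((\<lambda>t. t - sin t * (22/15 - 3/5 * cos t + 2/15 * cos t ^ 2))
      has_real_derivative 2/5 * (1 - cos t) ^ 3) (at t)"
      unfolding e[symmetric]
      by (auto intro!: derivative_eq_intros simp: field_simps power2_eq_square power3_eq_cube)
  qed auto
  then show ?thesis by simp
qed

lemma angle_ratio_ge:
  assumes t: "0 \<le> t" "t \<le> pi/2"
  shows "22/15 - 3/5 * cos t + 2/15 * cos t ^ 2 \<le> angle_ratio t"
proof (cases "t = 0")
  case False
  then have "sin t > 0" using assms by (intro sin_gt_zero) auto
  then show ?thesis using quadratic_bound_below_angle[OF t] False
    by (simp add: angle_ratio_def field_simps)
qed (simp add: angle_ratio_def)

lemma angle_ratio_ge_one: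
  assumes t: "0 \<le> t" "t \<le> pi/2"
  shows "1 \<le> angle_ratio t"
proof (cases "t = 0")
  case False
  then have "sin t > 0" using assms by (intro sin_gt_zero) auto
  then show ?thesis using sin_x_le_x[of t] t False
    by (simp add: angle_ratio_def field_simps)
qed (simp add: angle_ratio_def)

lemma angle_mult_cos_le_sin:
  assumes "0 \<le> t" "t \<le> pi/2"
  shows "t * cos t \<le> sin t"
proof -
  have "0 \<le> sin t - t * cos t"
  proof (rule nonneg_on_quadrant_by_deriv[where f' = "\<lambda>t. t * sin t", OF _ _ _ assms])
    fix t :: real show "((\<lambda>t. sin t - t * cos t) has_real_derivative t * sin t) (at t)"
      by (auto intro!: derivative_eq_intros)
  qed (auto intro!: mult_nonneg_nonneg sin_ge_zero)
  then show ?thesis by simp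
qed

lemma angle_ratio_mono:
  assumes "0 \<le> s" "s \<le> t" "t \<le> pi/2"
  shows "angle_ratio s \<le> angle_ratio t"
proof (cases "s = 0")
  case True
  then show ?thesis using angle_ratio_ge_one[of t] assms by (simp add: angle_ratio_def)
next
  case False
  have "s / sin s \<le> t / sin t"
  proof (rule DERIV_nonneg_imp_nondecreasing[OF assms(2)])
    fix x assume x: "s \<le> x" "x \<le> t"
    then have sx: "sin x > 0" using assms False by (intro sin_gt_zero) auto
    have "x * cos x \<le> sin x" using x assms by (intro angle_mult_cos_le_sin) auto
    then show "\<exists>y. ((\<lambda>x. x / sin x) has_real_derivative y) (at x) \<and> 0 \<le> y"
      using sx
      by (intro exI[of _ "(sin x - x * cos x) / (sin x * sin x)"])
        (auto intro!: derivative_eq_intros)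
  qed
  then show ?thesis using False assms by (simp add: angle_ratio_def)
qed

lemma angle_ratio_cos_antimono:
  assumes "0 \<le> s" "s \<le> t" "t \<le> pi/2"
  shows "angle_ratio t * cos t \<le> angle_ratio s * cos s"
proof -
  have aux: "x * cos x / sin x \<le> y * cos y / sin y" if "0 < y" "y \<le> x" "x \<le> pi/2" for x y
  proof (rule DERIV_nonpos_imp_nonincreasing[OF that(2)])
    fix z assume z: "y \<le> z" "z \<le> x"
    then have sz: "sin z > 0" using that by (intro sin_gt_zero) auto
    have "sin z * cos z \<le> z * 1" 
      using sin_x_le_x[of z] z that cos_in_unit[of z] by (intro mult_mono) auto
    then have "(cos z * sin z - z) \<le> 0" by (simp add: mult.commute)
    moreover have "(cos z - z * sin z) * sin z - z * cos z * cos z = cos z * sin z - z"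
    proof -
      have "sin z * sin z = 1 - cos z * cos z" by (metis power2_eq_square sin_squared_eq)
      then show ?thesis by (simp only: left_diff_distrib mult.assoc) (simp add: algebra_simps)
    qed
    ultimately show "\<exists>d. ((\<lambda>x. x * cos x / sin x) has_real_derivative d) (at z) \<and> d \<le> 0"
      using sz
      by (intro exI[of _ "((cos z - z * sin z) * sin z - z * cos z * cos z) / (sin z * sin z)"])
        (auto intro!: derivative_eq_intros divide_nonpos_pos simp: algebra_simps)
  qed
  show ?thesis
  proof (cases "s = 0")
    case True
    have "t * cos t \<le> sin t" using assms by (intro angle_mult_cos_le_sin) auto
    moreover have "t \<noteq> 0 \<Longrightarrow> sin t > 0" using assms by (intro sin_gt_zero) auto
    ultimately show ?thesis using True by (auto simp: angle_ratio_def field_simps)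
  next
    case False
    then show ?thesis using aux[of s t] assms by (simp add: angle_ratio_def)
  qed
qed

text \<open>
  The derivative is \<open>1 - 6/5 x + 3/5 x\<^sup>2\<close>, a simple upper bound on \<open>[0, 1]\<close> of half the second
  derivative of \<open>arccos\<^sup>2\<close>. Unlike that second derivative it can be integrated in closed form.
\<close>

definition slope_corrector :: "real \<Rightarrow> real" where
  "slope_corrector x = x - 3/5 * x^2 + 1/5 * x^3"

text \<open>
  Differentiating, this is the bound on the second derivative of \<open>arccos\<^sup>2\<close> announced above: with
  \<open>u = cos \<theta>\<close>, the function is \<open>-1/2\<close> times the derivative of \<open>arccos\<^sup>2\<close>, plus the integral of
  the bound, and it increases with \<open>u\<close>.
\<close>

lemma corrected_ratio_antimono:
  assumes "0 \<le> s" "s \<le> t" "t \<le> pi/2"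
  shows "angle_ratio t + slope_corrector (cos t) \<le> angle_ratio s + slope_corrector (cos s)"
proof (cases "s = 0")
  case True
  show ?thesis
  proof (cases "t = 0")
    case False
    then have "sin t > 0" using assms by (intro sin_gt_zero) auto
    then show ?thesis using angle_le_cubic_bound[of t] assms True False
      by (simp add: angle_ratio_def slope_corrector_def field_simps)
  qed (use True in simp)
next
  case False
  have "t / sin t + slope_corrector (cos t) \<le> s / sin s + slope_corrector (cos s)"
  proof (rule DERIV_nonpos_imp_nonincreasing[OF assms(2)])
    fix x assume x: "s \<le> x" "x \<le> t"
    then have sx: "sin x > 0" using assms False by (intro sin_gt_zero) auto
    define u where "u = cos x"
    have s2: "sin x * sin x = 1 - u ^ 2" unfolding u_def by (metis power2_eq_square sin_squared_eq)
    have u: "0 \<le> u" "u \<le> 1" using cos_in_unit[of x] x assms by (auto simp: u_def)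
    let ?d = "(sin x - x * u) / (sin x * sin x) - sin x * (1 - 6/5 * u + 3/5 * u^2)"
    have b: "sin x * (6/5 + 2/5 * u - 6/5 * u ^ 2 + 3/5 * u ^ 3) \<le> x"
      using cubic_bound_below_angle[of x] x assms by (simp add: u_def)
    have "(sin x - x * u) \<le> sin x - (sin x * (6/5 + 2/5 * u - 6/5 * u ^ 2 + 3/5 * u ^ 3)) * u"
      using mult_right_mono[OF b u(1)] by simp
    also have "\<dots> = sin x * (1 - 6/5 * u + 3/5 * u^2) * (1 - u^2)"
      by (simp add: field_simps power2_eq_square power3_eq_cube)
    finally have "?d \<le> 0" using sx unfolding s2[symmetric]
      by (simp add: pos_divide_le_eq)
    moreover have "((\<lambda>x. x / sin x + slope_corrector (cos x)) has_real_derivative ?d) (at x)"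
      unfolding slope_corrector_def u_def using sx
      by (auto intro!: derivative_eq_intros simp: algebra_simps power2_eq_square power3_eq_cube)
    ultimately show "\<exists>y. ((\<lambda>x. x / sin x + slope_corrector (cos x)) has_real_derivative y) (at x) \<and> y \<le> 0"
      by blast
  qed
  then show ?thesis using False assms by (simp add: angle_ratio_def)
qed

text \<open>
  Second-order Taylor estimate for \<open>arccos\<^sup>2\<close>, read in the angle instead of the cosine: the
  cosine has an endpoint at 1, where \<open>arccos\<close> is not differentiable, but the angle
  has none. The remainder is the twice integrated bound on the second derivative.
\<close>

lemma squared_angle_le_tangent:
  assumes a: "0 \<le> \<alpha>" "\<alpha> \<le> pi/2" and b: "0 \<le> \<beta>" "\<beta> \<le> pi/2"
  shows "\<alpha>^2 \<le> \<beta>^2 - 2 * angle_ratio \<beta> * (cos \<alpha> - cos \<beta>)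
    + (cos \<alpha> - cos \<beta>)^2 * (1 - 2/5 * (cos \<alpha> + 2 * cos \<beta>)
        + 1/10 * (cos \<alpha>^2 + 2 * cos \<alpha> * cos \<beta> + 3 * cos \<beta>^2))"
proof -
  define Q where "Q x = x^2/2 - x^3/5 + x^4/20" for x :: real
  define E where "E x = \<beta>^2 - x^2 - 2 * angle_ratio \<beta> * (cos x - cos \<beta>)
    + 2 * (Q (cos x) - Q (cos \<beta>) - slope_corrector (cos \<beta>) * (cos x - cos \<beta>))" for x
  define E' where "E' x = 2 * sin x * (angle_ratio \<beta> + slope_corrector (cos \<beta>)
     - (angle_ratio x + slope_corrector (cos x)))" for x
  have dE: "(E has_real_derivative E' x) (at x)" if "0 \<le> x" "x \<le> pi/2" for x
  proof -
    have "(E has_real_derivative - 2 * x + 2 * angle_ratio \<beta> * sin x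
      + 2 * (- sin x * slope_corrector (cos x) + slope_corrector (cos \<beta>) * sin x)) (at x)"
      unfolding E_def Q_def slope_corrector_def
      by (auto intro!: derivative_eq_intros simp: algebra_simps power2_eq_square power3_eq_cube)
    moreover have "- 2 * x + 2 * angle_ratio \<beta> * sin x
      + 2 * (- sin x * slope_corrector (cos x) + slope_corrector (cos \<beta>) * sin x) = E' x"
      unfolding E'_def using angle_ratio_times_sin[OF that] by (simp add: algebra_simps)
    ultimately show ?thesis by simp
  qed
  have "E \<beta> \<le> E \<alpha>"
  proof (cases "\<alpha> \<le> \<beta>")
    case True
    show ?thesis
    proof (rule DERIV_nonpos_imp_nonincreasing[OF True])
      fix x assume x: "\<alpha> \<le> x" "x \<le> \<beta>"
      then have "E' x \<le> 0" unfolding E'_def using corrected_ratio_antimono[of x \<beta>] a b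
        by (intro mult_nonneg_nonpos) (auto intro!: sin_ge_zero)
      then show "\<exists>y. (E has_real_derivative y) (at x) \<and> y \<le> 0" using dE[of x] x a b by auto
    qed
  next
    case False
    then have "\<beta> \<le> \<alpha>" by simp
    then show ?thesis
    proof (rule DERIV_nonneg_imp_nondecreasing)
      fix x assume x: "\<beta> \<le> x" "x \<le> \<alpha>"
      then have "E' x \<ge> 0" unfolding E'_def using corrected_ratio_antimono[of \<beta> x] a b
        by (intro mult_nonneg_nonneg) (auto intro!: sin_ge_zero)
      then show "\<exists>y. (E has_real_derivative y) (at x) \<and> 0 \<le> y" using dE[of x] x a b by auto
    qed
  qed
  moreover have "E \<beta> = 0" by (simp add: E_def)
  moreover have "2 * (Q (cos \<alpha>) - Q (cos \<beta>) - slope_corrector (cos \<beta>) * (cos \<alpha> - cos \<beta>))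
    = (cos \<alpha> - cos \<beta>)^2 * (1 - 2/5 * (cos \<alpha> + 2 * cos \<beta>)
        + 1/10 * (cos \<alpha>^2 + 2 * cos \<alpha> * cos \<beta> + 3 * cos \<beta>^2))"
    unfolding Q_def slope_corrector_def by algebra
  ultimately show ?thesis unfolding E_def by linarith
qed

text \<open>
  The remainder polynomial of the Taylor estimate at \<open>a = u/2\<close>, \<open>b = u\<close>, its worst case
  over \<open>a \<ge> u/2\<close>, \<open>b \<ge> u\<close>.
\<close>

definition curvature_const :: "real \<Rightarrow> real" where
  "curvature_const u = 1 - u + 17/40 * u^2"

text \<open>
  The asymmetric ranges fit one step of the method: \<open>b\<close> is the cosine of an old angle, at least
  \<open>u\<close>, and the step may at most halve this lower bound for the new cosine \<open>a\<close>.
\<close>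

lemma squared_arccos_le_quadratic:
  assumes u: "0 \<le> u" and a: "u/2 \<le> a" "a \<le> 1" and b: "u \<le> b" "b \<le> 1"
  shows "(arccos a)^2 \<le> (arccos b)^2 - 2 * angle_ratio (arccos b) * (a - b)
    + curvature_const u * (a - b)^2"
proof -
  have ab: "0 \<le> a" "0 \<le> b" using u a b by auto
  have *: "(arccos a)^2 \<le> (arccos b)^2 - 2 * angle_ratio (arccos b) * (a - b)
    + (a - b)^2 * (1 - 2/5 * (a + 2 * b) + 1/10 * (a^2 + 2 * a * b + 3 * b^2))"
    using squared_angle_le_tangent[of "arccos a" "arccos b"] ab a b
      arccos_le_pi2[of a] arccos_le_pi2[of b] arccos_lbound[of a] arccos_lbound[of b] by simp
  define f where "f x y = - 2/5 * (x + 2 * y) + 1/10 * (x^2 + 2 * x * y + 3 * y^2)" for x y :: real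
  have "f a b - f (u/2) b = (a - u/2) * (- 2/5 + 1/10 * (a + u/2 + 2 * b))"
    unfolding f_def by (simp add: field_simps power2_eq_square)
  also have "\<dots> \<le> 0" using a b u by (intro mult_nonneg_nonpos) auto
  finally have 1: "f a b \<le> f (u/2) b" by simp
  have "f (u/2) b - f (u/2) u = (b - u) * (- 4/5 + 1/10 * (u + 3 * (b + u)))"
    unfolding f_def by (simp add: field_simps power2_eq_square)
  also have "\<dots> \<le> 0" using a b u by (intro mult_nonneg_nonpos) auto
  finally have 2: "f (u/2) b \<le> f (u/2) u" by simp
  have "1 + f (u/2) u = curvature_const u" unfolding f_def curvature_const_def by (simp add: field_simps power2_eq_square)
  then have "1 - 2/5 * (a + 2 * b) + 1/10 * (a^2 + 2 * a * b + 3 * b^2) \<le> curvature_const u"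
    using 1 2 unfolding f_def by linarith
  from mult_left_mono[OF this, of "(a-b)^2"] * show ?thesis by (simp add: mult.commute)
qed

lemma curvature_const_nonneg:
  assumes "0 \<le> u" "u \<le> 1" shows "0 \<le> curvature_const u"
  using assms by (simp add: curvature_const_def)

text \<open>
  The single numerical inequality behind the rate. The left-hand side is the coefficient of the
  squared step length in the distance estimate; the right-hand side is what the linear term can
  pay for while leaving a decrease proportional to \<open>4/\<pi>\<^sup>2 (t / sin t)\<^sup>2\<close>. With
  \<open>u = cos t\<close>, the bounds on the angle reduce it to a quartic in \<open>u\<close>.
\<close>

lemma step_budget:
  assumes t: "0 \<le> t" "t \<le> pi/2"
  shows "1 + curvature_const (cos t) + t * cos t / 6
    \<le> 2 * angle_ratio t - 4 / pi^2 * (angle_ratio t)^2"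
proof -
  define u r r0 where "u = cos t" and "r = angle_ratio t"
    and "r0 = 22/15 - 3/5 * u + 2/15 * u^2"
  have u: "0 \<le> u" "u \<le> 1" using cos_in_unit[OF t] by (auto simp: u_def)
  have r0r: "r0 \<le> r" using angle_ratio_ge[OF t] by (simp add: r0_def r_def u_def)
  have u2: "u^2 \<le> 1" using u by (simp add: power_le_one)
  have pi: "3.141 \<le> pi" "pi \<le> 3.142" using pi_approx by auto
  have "4 / pi^2 \<le> 4 / 3.141^2" using pi by (intro divide_left_mono power_mono) auto
  then have p4: "4 / pi^2 \<le> 0.406" by (simp add: power2_eq_square)
  have "r \<le> angle_ratio (pi/2)" unfolding r_def using t by (intro angle_ratio_mono) auto
  then have r_ub: "r \<le> 1.571" using pi by (simp add: angle_ratio_def)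
  have "u = sin (pi/2 - t)" by (simp add: u_def sin_cos_eq)
  also have "\<dots> \<le> pi/2 - t" using t by (intro sin_x_le_x) auto
  finally have "t \<le> 1.571 - u" using pi by simp
  then have tu: "t * u / 6 \<le> (1.571 - u) * u / 6" using u by (simp add: mult_right_mono)
  have "0 \<le> r0" unfolding r0_def using u u2 by (simp add: add_increasing2)
  have "(r - r0) * (2 - 0.406 * (r + r0)) \<ge> 0" 
    using r0r r_ub by (intro mult_nonneg_nonneg) auto
  moreover have "(r - r0) * (2 - 0.406 * (r + r0)) = (2 * r - 0.406 * r^2) - (2 * r0 - 0.406 * r0^2)"
    by (simp add: field_simps power2_eq_square)
  ultimately have "2 * r0 - 0.406 * r0^2 \<le> 2 * r - 0.406 * r^2" by linarith
  moreover have "1 + (1 - u + 17/40 * u^2) + (1.571 - u) * u / 6 \<le> 2 * r0 - 0.406 * r0^2"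
  proof -
    have "2 * r0 - 0.406 * r0^2 - (1 + (1 - u + 17/40 * u^2) + (1.571 - u) * u / 6)
       \<ge> 0"
    proof -
      have u32: "u^4 \<le> u^3" using u by (intro power_decreasing) auto
      have "u^2 \<le> u" using u by (simp add: power2_eq_square mult_left_le)
      moreover have "0 \<le> u^3" using u by simp
      moreover have "2 * r0 - 0.406 * r0^2 - (1 + (1 - u + 17/40 * u^2) + (1.571 - u) * u / 6)
        = 1687/28125 + 37909/150000 * u - 66739/225000 * u^2 + 203/3125 * u^3 - 203/28125 * u^4"
        unfolding r0_def by (simp add: field_simps power2_eq_square power3_eq_cube power4_eq_xxxx)
      ultimately show ?thesis using u u32 by linarith
    qed
    then show ?thesis by simp
  qed
  moreover have "4 / pi^2 * r^2 \<le> 0.406 * r^2" using p4 by (intro mult_right_mono) auto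
  ultimately show ?thesis using tu unfolding u_def r_def curvature_const_def by linarith
qed

section \<open>Matrices with orthonormal columns\<close>

lemma inner_mult_vec: "(A *v x) \<bullet> y = x \<bullet> (transpose A *v y)" for A :: "real^'m^'n"
  by (metis dot_lmul_matrix inner_commute transpose_matrix_vector transpose_transpose)

lemma gram_entry: "(transpose Y ** X) $ i $ j = column i Y \<bullet> column j X"
  for X :: "real^'k^'n" and Y :: "real^'m^'n"
  by (simp add: matrix_matrix_mult_def transpose_def column_def inner_vec_def)

lemma orthonormal_columns_iff:
  "transpose X ** X = mat 1 \<longleftrightarrow> (\<forall>i j. column i X \<bullet> column j X = (if i = j then 1 else 0))"
  for X :: "real^'k^'n"
  by (simp add: vec_eq_iff gram_entry mat_def)

lemma column_mult: "column j (A ** B) = A *v column j B"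
  by (simp add: vec_eq_iff column_def matrix_matrix_mult_def matrix_vector_mult_def)

lemma column_mult_diag: "column j (A ** diag d) = d $ j *\<^sub>R column j A"
  by (simp add: vec_eq_iff column_def matrix_matrix_mult_def diag_def if_distrib mult.commute cong: if_cong)

lemma transpose_diag: "transpose (diag d) = diag d"
  by (simp add: vec_eq_iff transpose_def diag_def)

lemma diag_mult_vec: "diag a *v x = (\<chi> i. a $ i * x $ i)"
  by (simp add: vec_eq_iff matrix_vector_mult_def diag_def if_distrib if_distribR cong: if_cong)

lemma matrix_eq_columnsI: "(\<And>j. column j A = column j B) \<Longrightarrow> A = B"
  by (simp add: vec_eq_iff column_def)

lemma column_diag: "column j (diag d) = d $ j *\<^sub>R axis j 1"
  by (simp add: vec_eq_iff column_def diag_def axis_def)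

lemma diag_mult_diag: "diag a ** diag b = diag (\<chi> i. a $ i * b $ i)"
  by (rule matrix_eq_columnsI) (simp add: column_mult_diag column_diag)

lemma norm_matrix_columns: "(norm M)\<^sup>2 = (\<Sum>j\<in>UNIV. (norm (column j M))\<^sup>2)"
  for M :: "real^'k^'n"
proof -
  have "(norm M)\<^sup>2 = (\<Sum>i\<in>UNIV. \<Sum>j\<in>UNIV. (M $ i $ j)\<^sup>2)"
    unfolding power2_norm_eq_inner by (simp add: inner_vec_def power2_eq_square)
  also have "\<dots> = (\<Sum>j\<in>UNIV. \<Sum>i\<in>UNIV. (M $ i $ j)\<^sup>2)" by (rule sum.swap)
  also have "\<dots> = (\<Sum>j\<in>UNIV. (norm (column j M))\<^sup>2)"
    unfolding power2_norm_eq_inner by (simp add: inner_vec_def power2_eq_square column_def)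
  finally show ?thesis .
qed

lemma norm_transpose: "norm (transpose M) = norm M" for M :: "real^'k^'n"
proof -
  have "(norm (transpose M))\<^sup>2 = (norm M)\<^sup>2"
    unfolding norm_matrix_columns[of "transpose M"]
    by (simp add: power2_norm_eq_inner inner_vec_def row_def)
  then show ?thesis by simp
qed

lemma norm_orthonormal_mult:
  fixes U :: "real^'k^'n" and M :: "real^'m^'k"
  assumes "transpose U ** U = mat 1"
  shows "norm (U ** M) = norm M"
  by (simp add: norm_eq_sqrt_inner inner_matrix_mult_left matrix_mul_assoc assms)

lemma norm_mult_orthogonal:
  fixes Q :: "real^'k^'k" and M :: "real^'k^'n"
  assumes "orthogonal_matrix Q"
  shows "norm (M ** Q) = norm M"
proof -
  have "norm (M ** Q) = norm (transpose Q ** transpose M)"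
    by (metis norm_transpose matrix_transpose_mul)
  also have "\<dots> = norm (transpose M)"
    using assms by (intro norm_orthonormal_mult) (simp add: orthogonal_matrix_def)
  finally show ?thesis by (simp add: norm_transpose)
qed

lemma norm_diag: "(norm (diag d))\<^sup>2 = (\<Sum>i\<in>UNIV. (d $ i)\<^sup>2)"
proof -
  show ?thesis by (simp add: norm_matrix_columns column_diag power_mult_distrib)
qed

lemma norm_orthonormal_mult_vec:
  fixes U :: "real^'k^'n"
  assumes "transpose U ** U = mat 1"
  shows "norm (U *v x) = norm x"
  by (simp add: norm_eq_sqrt_inner inner_mult_vec matrix_vector_mul_assoc assms
      del: transpose_matrix_vector)

lemma norm_transpose_mult_vec_le:
  fixes U :: "real^'k^'n"
  assumes "transpose U ** U = mat 1"
  shows "norm (transpose U *v x) \<le> norm x"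
proof -
  have "(norm (transpose U *v x))\<^sup>2 = x \<bullet> (U *v (transpose U *v x))"
    by (simp add: power2_norm_eq_inner inner_mult_vec[of "transpose U"] del: transpose_matrix_vector)
  also have "\<dots> \<le> norm x * norm (U *v (transpose U *v x))" by (rule norm_cauchy_schwarz)
  also have "\<dots> = norm x * norm (transpose U *v x)"
    by (simp only: norm_orthonormal_mult_vec[OF assms])
  finally have "norm (transpose U *v x) * norm (transpose U *v x) \<le> norm x * norm (transpose U *v x)"
    by (simp only: power2_eq_square)
  then show ?thesis
    by (cases "norm (transpose U *v x) = 0") (simp_all only: mult_le_cancel_right norm_ge_zero, auto)
qed

lemma norm_transpose_mult_le:
  fixes U :: "real^'k^'n" and M :: "real^'m^'n"
  assumes "transpose U ** U = mat 1"
  shows "norm (transpose U ** M) \<le> norm M"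
proof -
  have "(norm (transpose U ** M))\<^sup>2 \<le> (norm M)\<^sup>2"
    unfolding norm_matrix_columns column_mult
    by (intro sum_mono power_mono norm_transpose_mult_vec_le assms) simp
  then show ?thesis by (rule power2_le_imp_le) simp
qed

lemma norm_mult_orthonormal_le:
  fixes U :: "real^'k^'n" and M :: "real^'n^'m"
  assumes "transpose U ** U = mat 1"
  shows "norm (M ** U) \<le> norm M"
proof -
  have "norm (M ** U) = norm (transpose U ** transpose M)"
    by (metis norm_transpose matrix_transpose_mul)
  also have "\<dots> \<le> norm M" using norm_transpose_mult_le[OF assms] by (metis norm_transpose)
  finally show ?thesis .
qed

lemma orthogonal_matrix_sums:
  fixes Q :: "real^'k^'k"
  assumes "orthogonal_matrix Q"
  shows "(\<Sum>i\<in>UNIV. (Q $ i $ j)\<^sup>2) = 1" "(\<Sum>j\<in>UNIV. (Q $ i $ j)\<^sup>2) = 1"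
proof -
  have "(transpose Q ** Q) $ j $ j = 1" "(Q ** transpose Q) $ i $ i = 1"
    using assms by (simp_all add: orthogonal_matrix_def mat_def)
  then show "(\<Sum>i\<in>UNIV. (Q $ i $ j)\<^sup>2) = 1" "(\<Sum>j\<in>UNIV. (Q $ i $ j)\<^sup>2) = 1"
    by (simp_all add: matrix_matrix_mult_def transpose_def power2_eq_square)
qed

lemma matrix_mult_add_left: "(A + B) ** C = A ** C + B ** C"
  for A B :: "real^'m^'n" and C :: "real^'k^'m"
  by (simp add: vec_eq_iff matrix_matrix_mult_def distrib_right sum.distrib)

lemma matrix_mult_add_right: "A ** (B + C) = A ** B + A ** C"
  for A :: "real^'m^'n" and B C :: "real^'k^'m"
  by (simp add: vec_eq_iff matrix_matrix_mult_def distrib_left sum.distrib)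

lemma transpose_diff: "transpose (A - B) = transpose A - transpose B" for A B :: "real^'k^'n"
  by (simp add: transpose_def vec_eq_iff)

lemma mult_diag_entry: "(A ** diag d) $ i $ j = A $ i $ j * d $ j" for A :: "real^'k^'n"
  using arg_cong[OF column_mult_diag[of j A d], of "\<lambda>v. v $ i"] by (simp add: column_def mult.commute)

lemma inner_transpose: "inner (transpose A) (transpose B) = inner A B" for A B :: "real^'k^'n"
  unfolding inner_vec_def transpose_def by (simp add: inner_vec_def) (rule sum.swap)

lemma inner_matrix_mult_right: "inner (A ** B) C = inner A (C ** transpose B)"
  for A :: "real^'m^'n" and B :: "real^'k^'m"
proof -
  have "inner (A ** B) C = inner (transpose B ** transpose A) (transpose C)"
    by (metis inner_transpose matrix_transpose_mul)
  also have "\<dots> = inner (transpose A) (transpose (C ** transpose B))"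
    by (simp add: inner_matrix_mult_left matrix_transpose_mul)
  finally show ?thesis by (simp only: inner_transpose)
qed

lemma inner_matrix_columns: "inner A B = (\<Sum>j\<in>UNIV. column j A \<bullet> column j B)" for A B :: "real^'k^'n"
  by (subst inner_transpose[symmetric]) (simp add: inner_vec_def transpose_def column_def)

lemma inner_diag_left: "inner (diag d) M = (\<Sum>i\<in>UNIV. d $ i * M $ i $ i)"
  unfolding inner_vec_def diag_def by (simp add: inner_vec_def if_distrib if_distribR cong: if_cong)

lemma norm_vec_square: "(norm x)\<^sup>2 = (\<Sum>j\<in>UNIV. (x $ j)\<^sup>2)" for x :: "real^'k"
  by (simp add: norm_vec_def L2_set_def sum_nonneg)

lemma norm_mult_vec_of_diag_gram:
  fixes Z :: "real^'k^'n"
  assumes "transpose Z ** Z = diag d"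
  shows "(norm (Z *v x))\<^sup>2 = (\<Sum>j\<in>UNIV. d $ j * (x $ j)\<^sup>2)"
proof -
  have "(norm (Z *v x))\<^sup>2 = x \<bullet> (diag d *v x)"
    by (simp only: power2_norm_eq_inner inner_mult_vec matrix_vector_mul_assoc assms(1))
  also have "\<dots> = (\<Sum>j\<in>UNIV. d $ j * (x $ j)\<^sup>2)"
    unfolding diag_mult_vec inner_vec_def by (simp add: power2_eq_square mult.left_commute)
  finally show ?thesis .
qed

lemma norm_mult_vec_le_of_diag_gram:
  fixes Z :: "real^'k^'n"
  assumes "transpose Z ** Z = diag d" "\<And>j. d $ j \<le> r\<^sup>2" "0 \<le> r"
  shows "norm (Z *v x) \<le> r * norm x"
proof -
  have "(norm (Z *v x))\<^sup>2 \<le> (\<Sum>j\<in>UNIV. r\<^sup>2 * (x $ j)\<^sup>2)"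
    unfolding norm_mult_vec_of_diag_gram[OF assms(1)] by (intro sum_mono mult_right_mono assms) simp
  also have "\<dots> = (r * norm x)\<^sup>2"
    by (simp only: power_mult_distrib norm_vec_square sum_distrib_left)
  finally show ?thesis by (rule power2_le_imp_le) (use assms(3) in simp)
qed

lemma norm_of_diag_gram:
  fixes Z :: "real^'k^'n"
  assumes "transpose Z ** Z = diag d"
  shows "(norm Z)\<^sup>2 = (\<Sum>j\<in>UNIV. d $ j)"
proof -
  have "(norm (column j Z))\<^sup>2 = (transpose Z ** Z) $ j $ j" for j
    by (simp only: power2_norm_eq_inner gram_entry)
  then show ?thesis by (simp add: norm_matrix_columns assms) (simp add: diag_def)
qed

lemma inner_le_sum_of_columns:
  fixes B U :: "real^'k^'n"
  assumes U: "transpose U ** U = mat 1" and B: "\<And>j. norm (column j B) \<le> r" and d: "\<And>j. 0 \<le> d $ j"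
  shows "inner B (U ** diag d) \<le> r * (\<Sum>j\<in>UNIV. d $ j)"
proof -
  have nu: "norm (column j U) = 1" for j
    using U by (simp add: orthonormal_columns_iff norm_eq_1)
  have "inner B (U ** diag d) = (\<Sum>j\<in>UNIV. d $ j * (column j B \<bullet> column j U))"
    by (simp add: inner_matrix_columns column_mult_diag)
  also have "\<dots> \<le> (\<Sum>j\<in>UNIV. d $ j * r)"
  proof (intro sum_mono mult_left_mono d)
    fix j show "column j B \<bullet> column j U \<le> r"
      using norm_cauchy_schwarz[of "column j B" "column j U"] nu B[of j] by simp
  qed
  finally show ?thesis by (simp add: sum_distrib_left mult.commute)
qed

definition matrix_of_columns :: "('k \<Rightarrow> real^'n) \<Rightarrow> real^'k^'n" where
  "matrix_of_columns v = (\<chi> a j. v j $ a)"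

lemma column_matrix_of_columns [simp]: "column j (matrix_of_columns v) = v j"
  by (simp add: matrix_of_columns_def column_def vec_eq_iff)

section \<open>Existence of singular value decompositions\<close>

lemma unit_vector_orthogonal_to:
  fixes v :: "'i::finite \<Rightarrow> real^'n"
  assumes "card F < CARD('n)"
  obtains w where "norm w = 1" "\<And>i. i \<in> F \<Longrightarrow> v i \<bullet> w = 0"
proof -
  have "dim (v ` F) \<le> card (v ` F)" by (rule dim_le_card') simp
  also have "\<dots> \<le> card F" by (rule card_image_le) simp
  finally have "dim (v ` F) < DIM(real^'n)" using assms by simp
  then obtain x where x: "x \<noteq> 0" "\<And>y. y \<in> span (v ` F) \<Longrightarrow> orthogonal x y"
    using orthogonal_to_subspace_exists by blast
  show ?thesis
  proof (rule that[of "x /\<^sub>R norm x"])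
    show "v i \<bullet> (x /\<^sub>R norm x) = 0" if "i \<in> F" for i
      using x(2)[of "v i"] that by (simp add: span_base orthogonal_def inner_commute)
  qed (use x in simp)
qed

lemma orthonormal_family_extend:
  fixes u :: "'k::finite \<Rightarrow> real^'n"
  assumes card: "CARD('k) \<le> CARD('n)"
    and on: "\<And>i j. i \<in> I \<Longrightarrow> j \<in> I \<Longrightarrow> u i \<bullet> u j = (if i = j then 1 else 0)"
  obtains w where "\<And>i j. w i \<bullet> w j = (if i = j then 1 else 0)" "\<And>i. i \<in> I \<Longrightarrow> w i = u i"
proof -
  have "\<exists>w. (\<forall>i\<in>I \<union> J. \<forall>j\<in>I \<union> J. w i \<bullet> w j = (if i = j then 1 else 0)) \<and> (\<forall>i\<in>I. w i = u i)" for J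
  proof (induction J rule: finite_induct[OF finite])
    case 1 then show ?case using on by (intro exI[of _ u]) auto
  next
    case (2 a J)
    then obtain w where w: "\<forall>i\<in>I \<union> J. \<forall>j\<in>I \<union> J. w i \<bullet> w j = (if i = j then 1 else 0)"
      "\<forall>i\<in>I. w i = u i" by blast
    show ?case
    proof (cases "a \<in> I")
      case True then show ?thesis using w by (intro exI[of _ w]) (auto simp: insert_absorb)
    next
      case False
      have "card (I \<union> J) < CARD('k)" using False 2 by (intro psubset_card_mono) auto
      then obtain x where x: "norm x = 1" "\<And>i. i \<in> I \<union> J \<Longrightarrow> w i \<bullet> x = 0"
        using card unit_vector_orthogonal_to[of "I \<union> J" w] by (metis order_less_le_trans)
      show ?thesis using w x False 2
        by (intro exI[of _ "w(a := x)"]) (auto simp: norm_eq_1 inner_commute)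
    qed
  qed
  from this[of UNIV] that show ?thesis by auto
qed

text \<open>
  First-order optimality: along \<open>w + t z\<close> the stretch of \<open>G\<close> is at most its maximum, and
  comparing the terms linear in \<open>t\<close> for small \<open>t\<close> forces the mixed product to vanish.
\<close>

lemma maximal_stretch_orthogonal:
  fixes G :: "real^'k^'n"
  assumes S: "subspace S" and w: "w \<in> S" "norm w = 1"
    and max: "\<And>y. y \<in> S \<Longrightarrow> norm y = 1 \<Longrightarrow> norm (G *v y) \<le> norm (G *v w)"
    and z: "z \<in> S" "w \<bullet> z = 0"
  shows "(G *v w) \<bullet> (G *v z) = 0"
proof -
  define b K where "b = (G *v w) \<bullet> (G *v z)" and "K = (norm (G *v w))\<^sup>2 * (norm z)\<^sup>2 - (norm (G *v z))\<^sup>2"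
  have ineq: "2 * t * b \<le> t\<^sup>2 * K" for t
  proof -
    define y where "y = w + t *\<^sub>R z"
    have y: "y \<in> S" unfolding y_def using S w z by (intro subspace_add subspace_scale)
    have ny: "(norm y)\<^sup>2 = 1 + t\<^sup>2 * (norm z)\<^sup>2"
      using w(2) z(2) unfolding y_def power2_norm_eq_inner
      by (simp add: inner_add_left inner_add_right inner_commute norm_eq_1 power2_eq_square)
    have "(norm y)\<^sup>2 > 0" unfolding ny by (intro add_pos_nonneg) auto
    then have y0: "norm y > 0" by simp
    have "norm (G *v (y /\<^sub>R norm y)) \<le> norm (G *v w)"
      using y0 y S by (intro max) (auto intro: subspace_scale)
    then have "norm (G *v y) \<le> norm (G *v w) * norm y"
      using y0 by (simp add: matrix_vector_mult_scaleR field_simps)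
    then have "(norm (G *v y))\<^sup>2 \<le> (norm (G *v w))\<^sup>2 * (norm y)\<^sup>2"
      by (metis norm_ge_zero power_mono power_mult_distrib)
    moreover have "(norm (G *v y))\<^sup>2 = (norm (G *v w))\<^sup>2 + 2 * t * b + t\<^sup>2 * (norm (G *v z))\<^sup>2"
      unfolding y_def b_def power2_norm_eq_inner
      by (simp add: matrix_vector_right_distrib matrix_vector_mult_scaleR inner_add_left
          inner_add_right inner_commute power2_eq_square algebra_simps)
    ultimately show ?thesis unfolding K_def ny by (simp add: algebra_simps)
  qed
  \<comment> \<open>The choice \<open>t = b / (\<bar>K\<bar> + 1)\<close> makes the linear term dominate.\<close>
  have "2 * b * b / (\<bar>K\<bar> + 1) \<le> b\<^sup>2 * K / (\<bar>K\<bar> + 1)\<^sup>2"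
    using ineq[of "b / (\<bar>K\<bar> + 1)"] by (simp add: power_divide mult.commute)
  then have "2 * b\<^sup>2 * (\<bar>K\<bar> + 1) \<le> b\<^sup>2 * K"
    by (simp add: divide_simps power2_eq_square split: if_splits)
  also have "\<dots> \<le> b\<^sup>2 * (\<bar>K\<bar> + 1)" by (intro mult_left_mono) auto
  finally have "b\<^sup>2 * (\<bar>K\<bar> + 1) \<le> 0" by linarith
  moreover have "\<not> \<bar>K\<bar> + 1 \<le> 0" by simp
  ultimately have "b = 0" by (simp add: mult_le_0_iff)
  then show ?thesis by (simp add: b_def)
qed

text \<open>
  The right singular vectors of \<open>G\<close>, obtained by repeatedly maximizing \<open>norm (G *v y)\<close> over unit
  vectors orthogonal to those already chosen.
\<close>

lemma orthonormal_basis_with_orthogonal_images: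
  fixes G :: "real^'k^'n"
  obtains v :: "'k \<Rightarrow> real^'k" where "\<And>i j. v i \<bullet> v j = (if i = j then 1 else 0)"
    "\<And>i j. i \<noteq> j \<Longrightarrow> (G *v v i) \<bullet> (G *v v j) = 0"
proof -
  define good where "good F v \<longleftrightarrow> (\<forall>i\<in>F. \<forall>j\<in>F. v i \<bullet> v j = (if i = j then 1 else 0))
      \<and> (\<forall>i\<in>F. \<forall>j\<in>F. i \<noteq> j \<longrightarrow> (G *v v i) \<bullet> (G *v v j) = 0)
      \<and> (\<forall>y. (\<forall>l\<in>F. v l \<bullet> y = 0) \<longrightarrow> (\<forall>i\<in>F. (G *v v i) \<bullet> (G *v y) = 0))"
    for F and v :: "'k \<Rightarrow> real^'k"
  have "\<exists>v. good F v" for F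
  proof (induction F rule: finite_induct[OF finite])
    case 1 then show ?case by (simp add: good_def)
  next
    case (2 a F)
    then obtain v where "good F v" by blast
    then have v: "\<And>i j. i \<in> F \<Longrightarrow> j \<in> F \<Longrightarrow> v i \<bullet> v j = (if i = j then 1 else 0)"
        "\<And>i j. i \<in> F \<Longrightarrow> j \<in> F \<Longrightarrow> i \<noteq> j \<Longrightarrow> (G *v v i) \<bullet> (G *v v j) = 0"
        "\<And>y i. (\<forall>l\<in>F. v l \<bullet> y = 0) \<Longrightarrow> i \<in> F \<Longrightarrow> (G *v v i) \<bullet> (G *v y) = 0"
      unfolding good_def by blast+
    define S where "S = {y. \<forall>l\<in>F. v l \<bullet> y = 0}"
    have S: "subspace S" by (simp add: S_def subspace_def inner_add_right)
    have "card F < CARD('k)" using 2 by (intro psubset_card_mono) auto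
    then obtain x where "norm x = 1" "\<And>i. i \<in> F \<Longrightarrow> v i \<bullet> x = 0"
      using unit_vector_orthogonal_to[of F v] by blast
    then have "x \<in> S \<inter> sphere 0 1" by (simp add: S_def)
    then have "S \<inter> sphere 0 1 \<noteq> {}" by blast
    moreover have "compact (S \<inter> sphere 0 1)"
      using S by (intro closed_Int_compact closed_subspace) auto
    moreover have "continuous_on (S \<inter> sphere 0 1) (\<lambda>y. norm (G *v y))"
      by (intro continuous_intros matrix_vector_mult_linear_continuous_on)
    ultimately obtain w where w0: "w \<in> S \<inter> sphere 0 1"
      "\<forall>y\<in>S \<inter> sphere 0 1. norm (G *v y) \<le> norm (G *v w)"
      using continuous_attains_sup[of "S \<inter> sphere 0 1" "\<lambda>y. norm (G *v y)"] by blast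
    then have w: "w \<in> S" "norm w = 1"
      "\<And>y. y \<in> S \<Longrightarrow> norm y = 1 \<Longrightarrow> norm (G *v y) \<le> norm (G *v w)" by simp_all
    have wF: "v i \<bullet> w = 0" "(G *v v i) \<bullet> (G *v w) = 0" if "i \<in> F" for i
      using w(1) v(3)[of w] that by (simp_all add: S_def)
    have wz: "(G *v w) \<bullet> (G *v z) = 0" if "z \<in> S" "w \<bullet> z = 0" for z
      using maximal_stretch_orthogonal[OF S w that] .
    define v' where "v' = v(a := w)"
    have v': "v' a = w" "\<And>i. i \<in> F \<Longrightarrow> v' i = v i" using 2 by (auto simp: v'_def)
    have on: "v' i \<bullet> v' j = (if i = j then 1 else 0)"
      if ij: "i \<in> insert a F" "j \<in> insert a F" for i j
    proof -
      consider "i = a" "j = a" | "i = a" "j \<in> F" "i \<noteq> j" | "j = a" "i \<in> F" "i \<noteq> j" | "i \<in> F" "j \<in> F"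
        using ij 2 by blast
      then show ?thesis
      proof cases
        case 1 then show ?thesis using w(2) v'(1) by (simp add: norm_eq_1)
      next
        case 2 then show ?thesis using wF(1)[of j] v' by (simp add: inner_commute)
      next
        case 3 then show ?thesis using wF(1)[of i] v' by simp
      next
        case 4 then show ?thesis using v(1)[of i j] v' by simp
      qed
    qed
    have im: "(G *v v' i) \<bullet> (G *v v' j) = 0"
      if ij: "i \<in> insert a F" "j \<in> insert a F" "i \<noteq> j" for i j
    proof -
      consider "i = a" "j \<in> F" | "j = a" "i \<in> F" | "i \<in> F" "j \<in> F" using ij by blast
      then show ?thesis
        using v(2)[of i j] wF(2) ij(3) v' by cases (simp_all add: inner_commute)
    qed
    have rest: "(G *v v' i) \<bullet> (G *v y) = 0"
      if "\<forall>l\<in>insert a F. v' l \<bullet> y = 0" "i \<in> insert a F" for y i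
    proof -
      have y: "y \<in> S" "w \<bullet> y = 0" using that(1) v' by (auto simp: S_def)
      show ?thesis
      proof (cases "i = a")
        case True then show ?thesis using wz[OF y] v' by simp
      next
        case False
        then have "i \<in> F" using that by blast
        then show ?thesis using v(3)[of y i] y v' by (simp add: S_def)
      qed
    qed
    have "good (insert a F) v'"
      unfolding good_def using on im rest by (intro conjI ballI allI impI) assumption+
    then show ?case by blast
  qed
  then obtain v where "good UNIV v" by blast
  then show ?thesis using that[of v] by (simp add: good_def)
qed

text \<open>
  The left singular vectors are the normalized images of the right ones; where the image is 0
  they are completed to an orthonormal family, for which the codomain must be large enough.
\<close>

lemma compact_svd_exists:
  fixes G :: "real^'k^'n"
  assumes "CARD('k) \<le> CARD('n)"
  obtains U s V where "compact_svd G U s V"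
proof -
  obtain v :: "'k \<Rightarrow> real^'k" where v: "\<And>i j. v i \<bullet> v j = (if i = j then 1 else 0)"
    "\<And>i j. i \<noteq> j \<Longrightarrow> (G *v v i) \<bullet> (G *v v j) = 0"
    using orthonormal_basis_with_orthogonal_images[of G] by blast
  define s :: "real^'k" where "s = (\<chi> i. norm (G *v v i))"
  define I where "I = {i. s $ i \<noteq> 0}"
  define u where "u i = (G *v v i) /\<^sub>R s $ i" for i
  have "u i \<bullet> u j = (if i = j then 1 else 0)" if "i \<in> I" "j \<in> I" for i j
  proof (cases "i = j")
    case True
    have "norm (u i) = 1" using that by (simp add: u_def I_def s_def)
    then show ?thesis using True by (simp add: norm_eq_1)
  next
    case False
    then show ?thesis using v(2)[of i j] by (simp add: u_def)
  qed
  then obtain w where w: "\<And>i j. w i \<bullet> w j = (if i = j then 1 else 0)" "\<And>i. i \<in> I \<Longrightarrow> w i = u i"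
    using orthonormal_family_extend[OF assms, of I u] by blast
  define U V where "U = matrix_of_columns w" and "V = matrix_of_columns v"
  have U: "transpose U ** U = mat 1" and V: "orthogonal_matrix V"
    unfolding orthogonal_matrix using v(1) w(1) by (simp_all add: orthonormal_columns_iff U_def V_def)
  have "G ** V = U ** diag s"
  proof (rule matrix_eq_columnsI)
    fix j
    show "column j (G ** V) = column j (U ** diag s)"
    proof (cases "j \<in> I")
      case True then show ?thesis 
        by (simp add: column_mult column_diag matrix_vector_mult_scaleR matrix_vector_mult_basis
            U_def V_def w u_def I_def)
    next
      case False then show ?thesis 
        by (simp add: column_mult column_diag matrix_vector_mult_scaleR matrix_vector_mult_basis
            U_def V_def I_def s_def)
    qed
  qed
  moreover have "G = G ** V ** transpose V"
    using V by (simp add: matrix_mul_assoc[symmetric] orthogonal_matrix_def)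
  ultimately have "G = U ** diag s ** transpose V" by simp
  then have "compact_svd G U s V" using U V by (simp add: compact_svd_def s_def)
  then show ?thesis by (rule that)
qed

section \<open>Representatives of subspaces, distances and geodesics\<close>

lemma mult_orthogonal_cancel:
  assumes "orthogonal_matrix Q"
  shows "A ** Q ** transpose Q = A" "A ** transpose Q ** Q = A"
  using assms by (simp_all add: matrix_mul_assoc[symmetric] orthogonal_matrix_def)

lemma span_columns_mult_subset: "span (columns (X ** B)) \<subseteq> span (columns X)"
  for X :: "real^'m^'n" and B :: "real^'k^'m"
proof (rule span_minimal)
  show "columns (X ** B) \<subseteq> span (columns X)"
  proof
    fix y assume "y \<in> columns (X ** B)"
    then obtain j where "y = X *v column j B" by (auto simp: columns_def column_mult)
    then show "y \<in> span (columns X)" by (simp only: matrix_vector_mult_in_columnspace)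
  qed
qed simp

lemma represents_mult_orthogonal:
  assumes "represents X S" "orthogonal_matrix Q"
  shows "represents (X ** Q) S"
proof -
  have "transpose (X ** Q) ** (X ** Q) = transpose Q ** (transpose X ** X) ** Q"
    by (simp only: matrix_transpose_mul matrix_mul_assoc)
  also have "\<dots> = mat 1" using assms by (simp add: represents_def orthogonal_matrix_def)
  finally have "transpose (X ** Q) ** (X ** Q) = mat 1" .
  moreover have "span (columns (X ** Q)) = span (columns X)"
    using span_columns_mult_subset[of X Q] span_columns_mult_subset[of "X ** Q" "transpose Q"]
      mult_orthogonal_cancel[OF assms(2), of X] by auto
  ultimately show ?thesis using assms by (simp add: represents_def)
qed

lemma projection_onto_span_columns:
  fixes X :: "real^'k^'n"
  assumes "transpose X ** X = mat 1" "y \<in> span (columns X)"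
  shows "X *v (transpose X *v y) = y"
  using assms(2)
proof (induction rule: span_induct)
  case base
  show ?case
    by (simp add: subspace_def matrix_vector_right_distrib matrix_vector_mult_scaleR del: transpose_matrix_vector)
next
  case (step y)
  then obtain j where "y = X *v axis j 1" by (auto simp: columns_def matrix_vector_mult_basis)
  then show ?case
    by (simp add: matrix_vector_mul_assoc matrix_mul_assoc[symmetric] assms(1) del: transpose_matrix_vector)
qed

lemma represents_unique_up_to_rotation:
  fixes X Y :: "real^'k^'n"
  assumes "represents X S" "represents Y S"
  obtains Q where "orthogonal_matrix Q" "Y = X ** Q"
proof (rule that)
  have X: "transpose X ** X = mat 1" and Y: "transpose Y ** Y = mat 1"
    using assms by (auto simp: represents_def)
  show eq: "Y = X ** (transpose X ** Y)"
  proof (rule matrix_eq_columnsI)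
    fix j
    have "column j Y \<in> span (columns X)"
      using assms by (auto simp: represents_def columns_def intro: span_base)
    then show "column j Y = column j (X ** (transpose X ** Y))"
      by (simp only: column_mult projection_onto_span_columns[OF X])
  qed
  have "transpose (transpose X ** Y) ** (transpose X ** Y) = transpose Y ** (X ** (transpose X ** Y))"
    by (simp add: matrix_transpose_mul matrix_mul_assoc)
  also have "\<dots> = mat 1" using Y by (simp only: eq[symmetric])
  finally show "orthogonal_matrix (transpose X ** Y)" by (simp add: orthogonal_matrix)
qed

lemma represents_exists:
  assumes "subspace S" "dim S = CARD('k)"
  obtains X :: "real^'k::finite^'n" where "represents X S"
proof -
  obtain B where B: "B \<subseteq> S" "pairwise orthogonal B" "\<And>x. x \<in> B \<Longrightarrow> norm x = 1"
    "independent B" "card B = dim S" "span B = S"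
    using orthonormal_basis_subspace[OF assms(1)] by metis
  have "finite B" using B(4) independent_imp_finite by blast
  then obtain h :: "'k \<Rightarrow> real^'n" where h: "bij_betw h UNIV B"
    using B(5) assms(2) finite_same_card_bij[of "UNIV :: 'k set" B] by auto
  define X where "X = matrix_of_columns h"
  have "columns X = B" using h by (auto simp: columns_def X_def bij_betw_def)
  moreover have "h i \<bullet> h j = (if i = j then 1 else 0)" for i j
  proof -
    have ij: "h i \<in> B" "h j \<in> B" "i \<noteq> j \<Longrightarrow> h i \<noteq> h j"
      using h by (auto simp: bij_betw_def inj_on_def)
    then show ?thesis using B(2) B(3)[of "h i"]
      by (auto simp: pairwise_def orthogonal_def norm_eq_1)
  qed
  then have "transpose X ** X = mat 1" by (simp add: orthonormal_columns_iff X_def)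
  ultimately show ?thesis using that B by (auto simp: represents_def)
qed

lemma represents_span_of_orthonormal:
  fixes u :: "'i \<Rightarrow> real^'n"
  assumes "\<And>i j. i \<in> I \<Longrightarrow> j \<in> I \<Longrightarrow> u i \<bullet> u j = (if i = j then 1 else 0)" "card I = CARD('k)" "finite I"
  obtains Y :: "real^'k::finite^'n" where "represents Y (span (u ` I))"
proof -
  have inj: "inj_on u I"
    using assms(1) by (intro inj_onI) (metis zero_neq_one)
  have "independent (u ` I)"
  proof (rule pairwise_orthogonal_independent)
    show "pairwise orthogonal (u ` I)"
      using assms(1) by (auto simp: pairwise_def orthogonal_def)
    show "0 \<notin> u ` I" using assms(1) by (metis image_iff inner_zero_left zero_neq_one)
  qed
  then have "dim (span (u ` I)) = CARD('k)"
    using assms(2) by (simp add: dim_eq_card_independent card_image[OF inj])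
  then show ?thesis using represents_exists[of "span (u ` I)"] that by auto
qed

lemma arccos_in_quadrant:
  assumes "0 \<le> x" "x \<le> 1"
  shows "arccos x \<in> {0..pi/2}"
  using arccos_lbound[of x] arccos_le_pi2[of x] assms by simp

text \<open>
  The distance is attained at representatives in principal position, \<open>Y\<^sup>T X\<close> diagonal: the
  singular value decomposition behind the chosen principal angles rotates the chosen
  representatives into that position.
\<close>

lemma gr_dist_principal_pairs:
  assumes "\<exists>X :: real^'k::finite^'n. represents X S" "\<exists>Y :: real^'k^'n. represents Y T"
  obtains X Y :: "real^'k^'n" and c :: "real^'k" where "represents X S" "represents Y T"
    "transpose Y ** X = diag c" "\<And>i. 0 \<le> c $ i" "\<And>i. c $ i \<le> 1"
    "gr_dist TYPE('k) S T = sqrt (\<Sum>i\<in>UNIV. (arccos (c $ i))\<^sup>2)"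
proof -
  let ?P = "\<lambda>d. \<exists>(X :: real^'k^'n) Y \<theta>s. represents X S \<and> represents Y T \<and>
     principal_angles X Y \<theta>s \<and> d = sqrt (\<Sum>\<theta>\<leftarrow>\<theta>s. \<theta>\<^sup>2)"
  have "\<exists>d. ?P d"
  proof -
    from assms obtain X Y :: "real^'k^'n" where XY: "represents X S" "represents Y T" by blast
    obtain U s V where svd: "compact_svd (transpose Y ** X) U s V" using compact_svd_exists by blast
    have s0: "0 \<le> s $ i" for i using svd by (simp add: compact_svd_def)
    have s1: "s $ i \<le> 1" for i
    proof -
      have X: "transpose X ** X = mat 1" and Y: "transpose Y ** Y = mat 1"
        and U: "transpose U ** U = mat 1" and V: "transpose V ** V = mat 1"
        and eq: "transpose Y ** X = U ** diag s ** transpose V"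
        using XY svd by (auto simp: represents_def compact_svd_def orthogonal_matrix_def)
      have "(transpose Y ** X) *v column i V = U *v (diag s *v ((transpose V ** V) *v axis i 1))"
        by (simp only: eq matrix_vector_mul_assoc matrix_mul_assoc matrix_vector_mult_basis[symmetric])
      then have "norm ((transpose Y ** X) *v column i V) = norm (diag s *v axis i 1)"
        using U V by (simp add: norm_orthonormal_mult_vec)
      also have "\<dots> = s $ i" using s0 by (simp add: matrix_vector_mult_basis column_diag)
      finally have "s $ i = norm (transpose Y *v (X *v column i V))"
        by (simp add: matrix_vector_mul_assoc del: transpose_matrix_vector)
      also have "\<dots> \<le> norm (X *v column i V)" by (rule norm_transpose_mult_vec_le[OF Y])
      also have "\<dots> = norm (V *v axis i 1)"
        by (simp add: norm_orthonormal_mult_vec[OF X] matrix_vector_mult_basis)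
      also have "\<dots> = 1" by (simp add: norm_orthonormal_mult_vec[OF V])
      finally show ?thesis .
    qed
    define \<theta>s where "\<theta>s = sorted_list_of_multiset (image_mset (\<lambda>i. arccos (s $ i)) (mset_set UNIV))"
    have "principal_angles X Y \<theta>s"
      unfolding principal_angles_def
    proof (intro conjI exI)
      show "sorted \<theta>s" by (simp add: \<theta>s_def)
      show "set \<theta>s \<subseteq> {0..pi/2}"
        using arccos_in_quadrant[OF s0 s1] by (simp add: \<theta>s_def image_subset_iff)
      show "compact_svd (transpose Y ** X) U s V" by fact
      have "mset (map cos \<theta>s) = image_mset (\<lambda>i. cos (arccos (s $ i))) (mset_set UNIV)"
        by (simp add: \<theta>s_def multiset.map_comp o_def)
      also have "\<dots> = image_mset (\<lambda>i. s $ i) (mset_set UNIV)"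
        using s0 s1 by (intro image_mset_cong cos_arccos) (auto intro: order_trans[of "-1" 0])
      finally show "mset (map cos \<theta>s) = image_mset (\<lambda>i. s $ i) (mset_set UNIV)" .
    qed
    then show ?thesis using XY by blast
  qed
  then have "?P (gr_dist TYPE('k) S T)" unfolding gr_dist_def by (rule someI_ex)
  then obtain X Y :: "real^'k^'n" and \<theta>s where XY: "represents X S" "represents Y T"
    and pa: "principal_angles X Y \<theta>s" and d: "gr_dist TYPE('k) S T = sqrt (\<Sum>\<theta>\<leftarrow>\<theta>s. \<theta>\<^sup>2)"
    by blast
  from pa obtain U s V where svd: "compact_svd (transpose Y ** X) U s V"
    and ms: "mset (map cos \<theta>s) = image_mset (\<lambda>i. s $ i) (mset_set UNIV)"
    and rng: "set \<theta>s \<subseteq> {0..pi/2}"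
    unfolding principal_angles_def by blast
  have U: "orthogonal_matrix U" and V: "orthogonal_matrix V"
    using svd by (simp_all add: compact_svd_def orthogonal_matrix)
  have s1: "s $ i \<le> 1" for i
  proof -
    have "s $ i \<in># mset (map cos \<theta>s)" unfolding ms by simp
    then show ?thesis by auto
  qed
  have "transpose (Y ** U) ** (X ** V) = transpose U ** (transpose Y ** X) ** V"
    by (simp only: matrix_transpose_mul matrix_mul_assoc)
  also have "\<dots> = transpose U ** U ** diag s ** (transpose V ** V)"
    using svd by (simp add: compact_svd_def matrix_mul_assoc)
  also have "\<dots> = diag s" using U V by (simp add: orthogonal_matrix_def)
  finally have diag: "transpose (Y ** U) ** (X ** V) = diag s" .
  have "mset \<theta>s = image_mset arccos (mset (map cos \<theta>s))"
  proof -
    have "map (\<lambda>t. arccos (cos t)) \<theta>s = \<theta>s"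
      using rng by (intro map_idI arccos_cos) auto
    then have "mset (map arccos (map cos \<theta>s)) = mset \<theta>s" by (simp add: o_def)
    then show ?thesis by (simp only: mset_map)
  qed
  then have "mset \<theta>s = image_mset (\<lambda>i. arccos (s $ i)) (mset_set UNIV)"
    unfolding ms by (simp add: multiset.map_comp o_def)
  moreover have "(\<Sum>\<theta>\<leftarrow>\<theta>s. \<theta>\<^sup>2) = (\<Sum>\<theta>\<in>#mset \<theta>s. \<theta>\<^sup>2)"
    by (simp flip: sum_mset_sum_list)
  ultimately have "(\<Sum>\<theta>\<leftarrow>\<theta>s. \<theta>\<^sup>2) = (\<Sum>i\<in>UNIV. (arccos (s $ i))\<^sup>2)"
    by (simp add: multiset.map_comp o_def sum_unfold_sum_mset)
  then show ?thesis
    using that[of "X ** V" "Y ** U" s] represents_mult_orthogonal[OF XY(1) V]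
      represents_mult_orthogonal[OF XY(2) U] diag s1 d svd by (simp add: compact_svd_def)
qed

lemma gr_dist_nonneg:
  assumes "\<exists>X :: real^'k::finite^'n. represents X S" "\<exists>Y :: real^'k^'n. represents Y T"
  shows "0 \<le> gr_dist TYPE('k) S T"
proof -
  obtain X Y :: "real^'k^'n" and c :: "real^'k"
    where "gr_dist TYPE('k) S T = sqrt (\<Sum>i\<in>UNIV. (arccos (c $ i))\<^sup>2)"
    using gr_dist_principal_pairs[OF assms] by metis
  then show ?thesis by (simp add: sum_nonneg)
qed

text \<open>
  Since \<open>G\<close> is tangent, each left singular vector with nonzero singular value is orthogonal to
  \<open>X\<close>; the others must be switched off by a zero of \<open>b\<close>. For \<open>a\<close>, \<open>b\<close> the cosine and sine this says
  that a geodesic stays orthonormal, for \<open>cos - 1\<close> and \<open>sin\<close> it measures the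
  displacement along the geodesic.
\<close>

lemma gram_of_tangent_combination:
  fixes X U G :: "real^'k^'n"
  assumes X: "transpose X ** X = mat 1" and tan: "transpose X ** G = 0"
    and svd: "compact_svd G U s R" and b: "\<And>j. s $ j = 0 \<Longrightarrow> b $ j = 0"
  shows "transpose (X ** R ** diag a + U ** diag b) ** (X ** R ** diag a + U ** diag b)
    = diag (\<chi> j. (a $ j)\<^sup>2 + (b $ j)\<^sup>2)"
proof -
  have R: "orthogonal_matrix R" and U: "transpose U ** U = mat 1"
    and G: "G = U ** diag s ** transpose R"
    using svd by (auto simp: compact_svd_def)
  have "transpose (X ** R) ** (X ** R) = mat 1"
    using represents_mult_orthogonal[of X "span (columns X)" R] X R by (simp add: represents_def)
  then have p: "column i (X ** R) \<bullet> column j (X ** R) = (if i = j then 1 else 0)" for i j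
    by (simp add: orthonormal_columns_iff)
  have u: "column i U \<bullet> column j U = (if i = j then 1 else 0)" for i j
    using U by (simp add: orthonormal_columns_iff)
  have "transpose (X ** R) ** (U ** diag s) = transpose R ** (transpose X ** G) ** R"
    unfolding G by (simp add: matrix_transpose_mul matrix_mul_assoc mult_orthogonal_cancel[OF R])
  also have "\<dots> = 0" unfolding tan by (simp add: vec_eq_iff matrix_matrix_mult_def)
  finally have "column i (X ** R) \<bullet> column j (U ** diag s) = 0" for i j
    by (metis gram_entry zero_index)
  then have cross: "b $ j * (column i (X ** R) \<bullet> column j U) = 0" for i j
    using b[of j] by (auto simp: column_mult_diag)
  have col: "column j (X ** R ** diag a + U ** diag b) = a $ j *\<^sub>R column j (X ** R) + b $ j *\<^sub>R column j U" for j
    by (simp add: column_mult_diag[symmetric]) (simp add: column_def vec_eq_iff)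
  show ?thesis
    unfolding vec_eq_iff gram_entry col
  proof (intro allI)
    fix i j
    let ?p = "\<lambda>j. column j (X ** R)" and ?u = "\<lambda>j. column j U"
    have "(a $ i *\<^sub>R ?p i + b $ i *\<^sub>R ?u i) \<bullet> (a $ j *\<^sub>R ?p j + b $ j *\<^sub>R ?u j)
      = a $ i * a $ j * (?p i \<bullet> ?p j) + a $ i * (b $ j * (?p i \<bullet> ?u j))
        + a $ j * (b $ i * (?p j \<bullet> ?u i)) + b $ i * b $ j * (?u i \<bullet> ?u j)"
      by (simp add: inner_add_left inner_add_right inner_commute[of "?u i" "?p j"] algebra_simps)
    then show "(a $ i *\<^sub>R ?p i + b $ i *\<^sub>R ?u i) \<bullet> (a $ j *\<^sub>R ?p j + b $ j *\<^sub>R ?u j)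
      = diag (\<chi> j. (a $ j)\<^sup>2 + (b $ j)\<^sup>2) $ i $ j"
      by (simp only: cross p u) (simp add: diag_def power2_eq_square)
  qed
qed

lemma represents_gr_exp:
  fixes X G :: "real^'k^'n"
  assumes X: "transpose X ** X = mat 1" and tan: "transpose X ** G = 0" and le: "CARD('k) \<le> CARD('n)"
  obtains U s R where "compact_svd G U s R"
    "represents (X ** R ** diag (\<chi> i. cos (s $ i)) + U ** diag (\<chi> i. sin (s $ i))) (gr_exp X G)"
proof -
  let ?P = "\<lambda>S. \<exists>U s V. compact_svd G U s V \<and>
     S = span (columns (X ** V ** diag (\<chi> i. cos (s $ i)) + U ** diag (\<chi> i. sin (s $ i))))"
  have "\<exists>S. ?P S" using compact_svd_exists[OF le] by metis
  then have "?P (gr_exp X G)" unfolding gr_exp_def by (rule someI_ex)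
  then obtain U s R where svd: "compact_svd G U s R"
    and S: "gr_exp X G = span (columns (X ** R ** diag (\<chi> i. cos (s $ i)) + U ** diag (\<chi> i. sin (s $ i))))"
    by blast
  have "diag (\<chi> j. (cos (s $ j))\<^sup>2 + (sin (s $ j))\<^sup>2) = mat 1"
    by (simp add: diag_def mat_def vec_eq_iff)
  then show ?thesis
    using that[OF svd] gram_of_tangent_combination[OF X tan svd, of "\<chi> i. sin (s $ i)" "\<chi> i. cos (s $ i)"]
    by (simp add: represents_def S)
qed

section \<open>The squared distance after a geodesic step\<close>

text \<open>
  A spectral version of the scalar bound on \<open>g\<close>. Averaging that bound over \<open>i\<close> and \<open>j\<close> with the
  doubly stochastic weights \<open>((P\<^sub>j\<^sub>i)\<^sup>2 + (Q\<^sub>j\<^sub>i)\<^sup>2) / 2\<close> almost gives the claim. The diagonal of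
  \<open>M\<close> carries the weights \<open>P\<^sub>j\<^sub>i Q\<^sub>j\<^sub>i\<close> instead, which are smaller; as the terms linear in \<open>s\<close> enter
  with the negative coefficients \<open>-2 (\<rho> + \<kappa> b)\<close>, replacing the weights only increases the
  right-hand side.
\<close>

lemma singular_value_sum_majorant:
  fixes P Q M :: "real^'k^'k" and s b h \<rho> :: "real^'k" and g :: "real \<Rightarrow> real"
  assumes P: "orthogonal_matrix P" and Q: "orthogonal_matrix Q"
    and M: "M = P ** diag s ** transpose Q"
    and s: "\<And>i. 0 \<le> s $ i" and b: "\<And>i. 0 \<le> b $ i" and \<rho>: "\<And>i. 0 \<le> \<rho> $ i" and \<kappa>: "0 \<le> \<kappa>"
    and g: "\<And>i j. g (s $ i) \<le> h $ j - 2 * \<rho> $ j * (s $ i - b $ j) + \<kappa> * (s $ i - b $ j)\<^sup>2"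
  shows "(\<Sum>i\<in>UNIV. g (s $ i)) \<le> (\<Sum>j\<in>UNIV. h $ j)
     - 2 * inner (diag \<rho>) (M - diag b) + \<kappa> * (norm (M - diag b))\<^sup>2"
proof -
  define w where "w i j = ((P $ j $ i)\<^sup>2 + (Q $ j $ i)\<^sup>2) / 2" for i j
  define m where "m j = (\<Sum>i\<in>UNIV. w i j * s $ i)" for j
  have w0: "0 \<le> w i j" for i j by (simp add: w_def)
  have w1: "(\<Sum>j\<in>UNIV. w i j) = 1" "(\<Sum>i\<in>UNIV. w i j) = 1" for i j
    unfolding w_def
    by (simp_all only: sum_divide_distrib[symmetric] sum.distrib
        orthogonal_matrix_sums[OF P] orthogonal_matrix_sums[OF Q]) simp_all
  have Mjj: "M $ j $ j = (\<Sum>i\<in>UNIV. P $ j $ i * Q $ j $ i * s $ i)" for j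
    unfolding M matrix_matrix_mult_def[of "P ** diag s"]
    by (simp add: mult_diag_entry transpose_def) (simp add: mult.commute mult.left_commute)
  have Mm: "M $ j $ j \<le> m j" for j
    unfolding Mjj m_def
  proof (intro sum_mono mult_right_mono s)
    fix i show "P $ j $ i * Q $ j $ i \<le> w i j"
      using sum_squares_bound[of "P $ j $ i" "Q $ j $ i"] by (simp add: w_def)
  qed
  have normM: "(norm M)\<^sup>2 = (\<Sum>i\<in>UNIV. (s $ i)\<^sup>2)"
  proof -
    have "norm M = norm (diag s)"
      unfolding M using P Q by (simp add: norm_mult_orthogonal norm_orthonormal_mult orthogonal_matrix_def)
    then show ?thesis by (simp add: norm_diag)
  qed
  have normMb: "(norm (M - diag b))\<^sup>2 = (\<Sum>i\<in>UNIV. (s $ i)\<^sup>2) - 2 * (\<Sum>j\<in>UNIV. b $ j * M $ j $ j) + (\<Sum>j\<in>UNIV. (b $ j)\<^sup>2)"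
  proof -
    have "(norm (M - diag b))\<^sup>2 = (norm M)\<^sup>2 - 2 * inner (diag b) M + (norm (diag b))\<^sup>2"
      by (simp add: power2_norm_eq_inner inner_diff_left inner_diff_right inner_commute)
    then show ?thesis by (simp add: normM norm_diag inner_diag_left)
  qed
  have "(\<Sum>i\<in>UNIV. g (s $ i)) = (\<Sum>i\<in>UNIV. \<Sum>j\<in>UNIV. w i j * g (s $ i))"
    by (simp only: sum_distrib_right[symmetric] w1 mult_1)
  also have "\<dots> \<le> (\<Sum>i\<in>UNIV. \<Sum>j\<in>UNIV. w i j * (h $ j - 2 * \<rho> $ j * (s $ i - b $ j) + \<kappa> * (s $ i - b $ j)\<^sup>2))"
    by (intro sum_mono mult_left_mono g w0)
  also have "\<dots> = (\<Sum>i\<in>UNIV. \<Sum>j\<in>UNIV. w i j * (h $ j + 2 * \<rho> $ j * b $ j + \<kappa> * (b $ j)\<^sup>2))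
      - 2 * (\<Sum>i\<in>UNIV. \<Sum>j\<in>UNIV. (\<rho> $ j + \<kappa> * b $ j) * (w i j * s $ i))
      + (\<Sum>i\<in>UNIV. \<Sum>j\<in>UNIV. w i j * (\<kappa> * (s $ i)\<^sup>2))"
  proof -
    have "w i j * (h $ j - 2 * \<rho> $ j * (s $ i - b $ j) + \<kappa> * (s $ i - b $ j)\<^sup>2)
      = w i j * (h $ j + 2 * \<rho> $ j * b $ j + \<kappa> * (b $ j)\<^sup>2)
        - 2 * ((\<rho> $ j + \<kappa> * b $ j) * (w i j * s $ i)) + w i j * (\<kappa> * (s $ i)\<^sup>2)" for i j
      by (simp add: power2_eq_square algebra_simps)
    then show ?thesis by (simp only: sum.distrib sum_subtractf sum_distrib_left)
  qed
  also have "(\<Sum>i\<in>UNIV. \<Sum>j\<in>UNIV. w i j * (h $ j + 2 * \<rho> $ j * b $ j + \<kappa> * (b $ j)\<^sup>2))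
      = (\<Sum>j\<in>UNIV. h $ j + 2 * \<rho> $ j * b $ j + \<kappa> * (b $ j)\<^sup>2)"
    by (subst sum.swap) (simp only: sum_distrib_right[symmetric] w1 mult_1)
  also have "(\<Sum>i\<in>UNIV. \<Sum>j\<in>UNIV. (\<rho> $ j + \<kappa> * b $ j) * (w i j * s $ i))
      = (\<Sum>j\<in>UNIV. (\<rho> $ j + \<kappa> * b $ j) * m j)"
    by (subst sum.swap) (simp add: m_def sum_distrib_left)
  also have "(\<Sum>i\<in>UNIV. \<Sum>j\<in>UNIV. w i j * (\<kappa> * (s $ i)\<^sup>2)) = \<kappa> * (\<Sum>i\<in>UNIV. (s $ i)\<^sup>2)"
    by (simp only: sum_distrib_right[symmetric] w1 mult_1 sum_distrib_left[symmetric])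
  finally have le: "(\<Sum>i\<in>UNIV. g (s $ i)) \<le> (\<Sum>j\<in>UNIV. h $ j + 2 * \<rho> $ j * b $ j + \<kappa> * (b $ j)\<^sup>2)
      - 2 * (\<Sum>j\<in>UNIV. (\<rho> $ j + \<kappa> * b $ j) * m j) + \<kappa> * (\<Sum>i\<in>UNIV. (s $ i)\<^sup>2)" .
  have "(\<Sum>j\<in>UNIV. (\<rho> $ j + \<kappa> * b $ j) * M $ j $ j) \<le> (\<Sum>j\<in>UNIV. (\<rho> $ j + \<kappa> * b $ j) * m j)"
    using \<rho> \<kappa> b by (intro sum_mono mult_left_mono Mm) simp
  moreover have "(\<Sum>j\<in>UNIV. h $ j + 2 * \<rho> $ j * b $ j + \<kappa> * (b $ j)\<^sup>2)
      = (\<Sum>j\<in>UNIV. h $ j) + 2 * (\<Sum>j\<in>UNIV. \<rho> $ j * b $ j) + \<kappa> * (\<Sum>j\<in>UNIV. (b $ j)\<^sup>2)"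
    by (simp add: sum.distrib sum_distrib_left mult.assoc)
  moreover have "(\<Sum>j\<in>UNIV. (\<rho> $ j + \<kappa> * b $ j) * M $ j $ j)
      = (\<Sum>j\<in>UNIV. \<rho> $ j * M $ j $ j) + \<kappa> * (\<Sum>j\<in>UNIV. b $ j * M $ j $ j)"
    by (simp add: sum.distrib sum_distrib_left distrib_right mult.assoc)
  moreover have "inner (diag \<rho>) (M - diag b) = (\<Sum>j\<in>UNIV. \<rho> $ j * M $ j $ j) - (\<Sum>j\<in>UNIV. \<rho> $ j * b $ j)"
    unfolding inner_diag_left by (simp add: diag_def right_diff_distrib sum_subtractf)
  moreover have "\<kappa> * (norm (M - diag b))\<^sup>2 = \<kappa> * (\<Sum>i\<in>UNIV. (s $ i)\<^sup>2)
     - 2 * (\<kappa> * (\<Sum>j\<in>UNIV. b $ j * M $ j $ j)) + \<kappa> * (\<Sum>j\<in>UNIV. (b $ j)\<^sup>2)"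
    unfolding normMb by (simp add: algebra_simps)
  ultimately show ?thesis using le by linarith
qed

text \<open>
  A weak form of the hinge comparison in nonnegative curvature, where the coefficient of
  \<open>(norm G)\<^sup>2\<close> would be 1. The columns of \<open>V ** diag \<rho>\<close> are, up to components in the span of \<open>X\<close>,
  the logarithm of the target at \<open>X\<close>. The majorant of singular values is applied to
  \<open>V\<^sup>T Y\<close>, a perturbation of \<open>V\<^sup>T X = diag c\<close>. Its quadratic term contributes the curvature
  constant. In its linear term, the second-order part of the geodesic contributes 1, and replacing
  \<open>sin \<sigma>\<close> by \<open>\<sigma>\<close> contributes the cubic error \<open>\<theta> * cos \<theta> / 6\<close>. Bounding the singular values of \<open>G\<close> by
  \<open>cos \<theta> / 2\<close> keeps those of \<open>V\<^sup>T Y\<close> above \<open>cos \<theta> / 2\<close>, the range of the scalar estimate.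
\<close>

lemma squared_distance_after_step:
  fixes X V G U Y :: "real^'k^'n" and c \<sigma> s :: "real^'k" and R P Q :: "real^'k^'k"
  defines "\<rho> \<equiv> (\<chi> i. angle_ratio (arccos (c $ i)))"
  assumes X: "transpose X ** X = mat 1" and V: "transpose V ** V = mat 1"
    and VX: "transpose V ** X = diag c" and c: "\<And>i. 0 \<le> c $ i" "\<And>i. c $ i \<le> 1"
    and \<theta>: "0 \<le> \<theta>" "\<theta> \<le> pi/2" and c\<theta>: "\<And>i. arccos (c $ i) \<le> \<theta>"
    and tan: "transpose X ** G = 0" and svd: "compact_svd G U \<sigma> R"
    and \<sigma>: "\<And>j. \<sigma> $ j \<le> cos \<theta> / 2"
    and Y: "Y = (X ** R ** diag (\<chi> i. cos (\<sigma> $ i)) + U ** diag (\<chi> i. sin (\<sigma> $ i))) ** transpose R"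
    and VY: "transpose V ** Y = P ** diag s ** transpose Q"
    and P: "orthogonal_matrix P" and Q: "orthogonal_matrix Q"
    and s: "\<And>i. 0 \<le> s $ i" "\<And>i. s $ i \<le> 1"
  shows "(\<Sum>i\<in>UNIV. (arccos (s $ i))\<^sup>2) \<le> (\<Sum>i\<in>UNIV. (arccos (c $ i))\<^sup>2)
     - 2 * inner (V ** diag \<rho>) G + (1 + curvature_const (cos \<theta>) + \<theta> * cos \<theta> / 6) * (norm G)\<^sup>2"
proof -
  define u where "u = cos \<theta>"
  have u: "0 \<le> u" "u \<le> 1" using cos_in_unit[OF \<theta>] by (auto simp: u_def)
  have R: "orthogonal_matrix R" and U: "transpose U ** U = mat 1" and \<sigma>0: "\<And>j. 0 \<le> \<sigma> $ j"
    and G: "G = U ** diag \<sigma> ** transpose R"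
    using svd by (auto simp: compact_svd_def)
  have Rt: "orthogonal_matrix (transpose R)" using R by simp
  have angle: "0 \<le> arccos (c $ i)" "arccos (c $ i) \<le> pi/2" "cos (arccos (c $ i)) = c $ i" for i
    using arccos_in_quadrant[OF c(1)[of i] c(2)[of i]] c(1)[of i] c(2)[of i] by auto
  have uc: "u \<le> c $ i" for i
    using cos_monotone_0_pi_le[OF angle(1) c\<theta>, of i] \<theta> angle(3)[of i] by (simp add: u_def)
  have normG: "(norm G)\<^sup>2 = (\<Sum>j\<in>UNIV. (\<sigma> $ j)\<^sup>2)"
    unfolding G by (simp add: norm_mult_orthogonal[OF Rt] norm_orthonormal_mult[OF U] norm_diag)
  define K where "K = R ** diag (\<chi> i. cos (\<sigma> $ i) - 1) ** transpose R"
  define T where "T = U ** diag (\<chi> i. \<sigma> $ i - sin (\<sigma> $ i)) ** transpose R"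
  define Z where "Z = X ** R ** diag (\<chi> i. cos (\<sigma> $ i) - 1) + U ** diag (\<chi> i. sin (\<sigma> $ i))"
  define E where "E = Z ** transpose R"
  have diag_diff: "diag (\<chi> i. f i - g i) = diag (\<chi> i. f i) - diag (\<chi> i. g i)" for f g :: "'k \<Rightarrow> real"
    by (simp add: diag_def vec_eq_iff)
  have EY: "E = Y - X"
  proof -
    have "diag (\<chi> i. 1) = (mat 1 :: real^'k^'k)" by (simp add: diag_def mat_def vec_eq_iff)
    then show ?thesis unfolding E_def Z_def Y diag_diff
      by (simp add: matrix_mult_diff_right matrix_mult_diff_left matrix_mult_add_left mult_orthogonal_cancel[OF R])
  qed
  \<comment> \<open>Second-order part in the directions of \<open>X\<close>, first-order part, and cubic error.\<close>
  have EKT: "E = X ** K + G - T"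
    unfolding E_def Z_def K_def G T_def diag_diff
    by (simp add: matrix_mult_diff_right matrix_mult_diff_left matrix_mult_add_left matrix_mul_assoc)
  have gramZ: "transpose Z ** Z = diag (\<chi> j. 2 - 2 * cos (\<sigma> $ j))"
  proof -
    have "(cos x - 1)\<^sup>2 + (sin x)\<^sup>2 = 2 - 2 * cos x" for x :: real
      using sin_cos_squared_add[of x] by (simp add: power2_eq_square algebra_simps)
    then show ?thesis unfolding Z_def
      using gram_of_tangent_combination[OF X tan svd, of "\<chi> i. sin (\<sigma> $ i)" "\<chi> i. cos (\<sigma> $ i) - 1"] by simp
  qed
  have chord: "2 - 2 * cos (\<sigma> $ j) \<le> (\<sigma> $ j)\<^sup>2" for j using one_minus_cos_le[of "\<sigma> $ j"] by simp
  have normE: "(norm E)\<^sup>2 \<le> (norm G)\<^sup>2"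
    unfolding E_def norm_mult_orthogonal[OF Rt] norm_of_diag_gram[OF gramZ] normG
    by (simp add: sum_mono chord)
  have E_vec: "norm (E *v x) \<le> u / 2 * norm x" for x
  proof -
    have "norm (E *v x) = norm (Z *v (transpose R *v x))"
      by (simp add: E_def matrix_vector_mul_assoc del: transpose_matrix_vector)
    also have "\<dots> \<le> u / 2 * norm (transpose R *v x)"
    proof (rule norm_mult_vec_le_of_diag_gram[OF gramZ])
      fix j show "(\<chi> j. 2 - 2 * cos (\<sigma> $ j)) $ j \<le> (u/2)\<^sup>2"
        using chord[of j] power_mono[OF \<sigma>[of j] \<sigma>0[of j], of 2] by (simp add: u_def)
    qed (use u in simp)
    also have "norm (transpose R *v x) = norm x"
      using R by (intro norm_orthonormal_mult_vec) (simp add: orthogonal_matrix_def)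
    finally show ?thesis .
  qed
  define M where "M = transpose V ** Y"
  have ME: "M - diag c = transpose V ** E"
    by (simp add: M_def EY matrix_mult_diff_right VX)
  \<comment> \<open>A singular value is the length of the image of its right singular vector.\<close>
  have s_lower: "u / 2 \<le> s $ i" for i
  proof -
    define q where "q = column i Q"
    have nq: "norm q = 1"
      using Q by (simp add: q_def orthogonal_matrix orthonormal_columns_iff norm_eq_1)
    have "M *v q = P *v (diag s *v ((transpose Q ** Q) *v axis i 1))"
      by (simp only: M_def VY q_def matrix_vector_mul_assoc matrix_mul_assoc matrix_vector_mult_basis[symmetric])
    then have "norm (M *v q) = norm (diag s *v axis i 1)"
      using P Q by (simp add: norm_orthonormal_mult_vec orthogonal_matrix_def)
    then have nM: "norm (M *v q) = s $ i"
      using s(1) by (simp add: matrix_vector_mult_basis column_diag)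
    have "u * norm q \<le> norm (diag c *v q)"
    proof -
      have "(u * norm q)\<^sup>2 = (\<Sum>j\<in>UNIV. u\<^sup>2 * (q $ j)\<^sup>2)"
        by (simp only: power_mult_distrib norm_vec_square sum_distrib_left)
      also have "\<dots> \<le> (\<Sum>j\<in>UNIV. (c $ j)\<^sup>2 * (q $ j)\<^sup>2)"
        by (intro sum_mono mult_right_mono power_mono uc u) simp
      also have "\<dots> = (norm (diag c *v q))\<^sup>2"
        by (simp add: diag_mult_vec norm_vec_square power_mult_distrib)
      finally show ?thesis by (rule power2_le_imp_le) simp
    qed
    moreover have "diag c *v q = M *v q - transpose V *v (E *v q)"
      by (simp add: matrix_vector_mul_assoc ME[symmetric] matrix_vector_mult_diff_rdistrib del: transpose_matrix_vector)
    moreover have "norm (transpose V *v (E *v q)) \<le> u / 2"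
      using norm_transpose_mult_vec_le[OF V, of "E *v q"] E_vec[of q] nq by simp
    ultimately show ?thesis
      using norm_triangle_ineq4[of "M *v q" "transpose V *v (E *v q)"] nM nq by (simp del: transpose_matrix_vector)
  qed
  have \<rho>: "0 \<le> \<rho> $ i" "\<rho> $ i * c $ i \<le> 1" for i
  proof -
    show "0 \<le> \<rho> $ i" using angle_ratio_ge_one[OF angle(1,2), of i] by (simp add: \<rho>_def)
    show "\<rho> $ i * c $ i \<le> 1"
      using angle_ratio_cos_antimono[of 0 "arccos (c $ i)"] angle[of i] by (simp add: \<rho>_def angle_ratio_def)
  qed
  have "(\<Sum>i\<in>UNIV. (arccos (s $ i))\<^sup>2) \<le> (\<Sum>j\<in>UNIV. (\<chi> j. (arccos (c $ j))\<^sup>2) $ j)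
     - 2 * inner (diag \<rho>) (M - diag c) + curvature_const u * (norm (M - diag c))\<^sup>2"
  proof (rule singular_value_sum_majorant[OF P Q _ s(1) c(1) \<rho>(1) curvature_const_nonneg[OF u]])
    show "M = P ** diag s ** transpose Q" by (simp add: M_def VY)
    fix i j
    show "(arccos (s $ i))\<^sup>2 \<le> (\<chi> j. (arccos (c $ j))\<^sup>2) $ j - 2 * \<rho> $ j * (s $ i - c $ j)
       + curvature_const u * (s $ i - c $ j)\<^sup>2"
      using squared_arccos_le_quadratic[OF u(1) s_lower s(2) uc c(2), of i j] by (simp add: \<rho>_def)
  qed
  moreover have "curvature_const u * (norm (M - diag c))\<^sup>2 \<le> curvature_const u * (norm G)\<^sup>2"
  proof (rule mult_left_mono[OF _ curvature_const_nonneg[OF u]])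
    have "(norm (M - diag c))\<^sup>2 \<le> (norm E)\<^sup>2"
      unfolding ME by (intro power_mono norm_transpose_mult_le V) simp
    then show "(norm (M - diag c))\<^sup>2 \<le> (norm G)\<^sup>2" using normE by simp
  qed
  moreover have "inner (diag \<rho>) (M - diag c) = inner (V ** diag \<rho>) (X ** K) + inner (V ** diag \<rho>) G - inner (V ** diag \<rho>) T"
    unfolding ME by (simp add: inner_matrix_mult_left EKT inner_diff_right inner_add_right matrix_mult_add_right matrix_mult_diff_right)
  moreover have "- inner (V ** diag \<rho>) (X ** K) \<le> (norm G)\<^sup>2 / 2"
  proof -
    have "inner (V ** diag \<rho>) (X ** K) = inner (diag \<rho>) (diag c ** K)"
      by (simp add: inner_matrix_mult_left matrix_mul_assoc VX)
    also have "\<dots> = inner (diag (\<chi> i. c $ i * \<rho> $ i)) K"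
      using inner_matrix_mult_left[of "diag c" "diag \<rho>" K] by (simp add: transpose_diag diag_mult_diag)
    also have "\<dots> = (\<Sum>i\<in>UNIV. c $ i * \<rho> $ i * K $ i $ i)" by (simp add: inner_diag_left)
    also have "- \<dots> = (\<Sum>i\<in>UNIV. c $ i * \<rho> $ i * (- K $ i $ i))" by (simp add: sum_negf)
    also have "\<dots> \<le> (\<Sum>i\<in>UNIV. (\<Sum>j\<in>UNIV. (R $ i $ j)\<^sup>2 * ((\<sigma> $ j)\<^sup>2 / 2)))"
    proof (rule sum_mono)
      fix i
      have Kii: "- K $ i $ i = (\<Sum>j\<in>UNIV. (R $ i $ j)\<^sup>2 * (1 - cos (\<sigma> $ j)))"
        unfolding K_def matrix_matrix_mult_def[of "R ** diag _"]
        by (simp add: mult_diag_entry transpose_def power2_eq_square flip: sum_negf) (simp add: algebra_simps)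
      have "0 \<le> - K $ i $ i" unfolding Kii by (intro sum_nonneg mult_nonneg_nonneg) auto
      then have "c $ i * \<rho> $ i * (- K $ i $ i) \<le> 1 * (- K $ i $ i)"
        using \<rho>(2)[of i] by (intro mult_right_mono) (auto simp: mult.commute)
      also have "\<dots> \<le> (\<Sum>j\<in>UNIV. (R $ i $ j)\<^sup>2 * ((\<sigma> $ j)\<^sup>2 / 2))"
        unfolding Kii mult_1 by (intro sum_mono mult_left_mono one_minus_cos_le) simp
      finally show "c $ i * \<rho> $ i * (- K $ i $ i) \<le> (\<Sum>j\<in>UNIV. (R $ i $ j)\<^sup>2 * ((\<sigma> $ j)\<^sup>2 / 2))" .
    qed
    also have "\<dots> = (\<Sum>j\<in>UNIV. \<Sum>i\<in>UNIV. (R $ i $ j)\<^sup>2 * ((\<sigma> $ j)\<^sup>2 / 2))" by (rule sum.swap)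
    also have "\<dots> = (norm G)\<^sup>2 / 2"
      by (simp only: normG sum_divide_distrib sum_distrib_right[symmetric] orthogonal_matrix_sums[OF R] mult_1)
    finally show ?thesis .
  qed
  moreover have "inner (V ** diag \<rho>) T \<le> \<theta> * u / 12 * (norm G)\<^sup>2"
  proof -
    define d where "d = (\<chi> i. \<sigma> $ i - sin (\<sigma> $ i))"
    \<comment> \<open>\<open>T\<close> is orthogonal to \<open>X\<close>, so only the part \<open>N\<close> of \<open>V\<close> normal to \<open>X\<close> counts; its columns have the length of the sines.\<close>
    define N where "N = V - X ** diag c"
    have XV: "transpose X ** V = diag c"
    proof -
      have "transpose (transpose V ** X) = transpose (diag c)" by (simp only: VX)
      then show ?thesis by (simp only: matrix_transpose_mul transpose_transpose transpose_diag)
    qed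
    have gramN: "transpose N ** N = diag (\<chi> i. 1 - (c $ i)\<^sup>2)"
    proof -
      have "transpose N = transpose V - diag c ** transpose X"
        by (simp add: N_def transpose_diff matrix_transpose_mul transpose_diag)
      then have "transpose N ** N = transpose V ** V - diag c ** (transpose X ** V)
         - (transpose V ** X ** diag c - diag c ** (transpose X ** X) ** diag c)"
        unfolding N_def by (simp only: matrix_mult_diff_left matrix_mult_diff_right matrix_mul_assoc)
      also have "\<dots> = mat 1 - diag c ** diag c"
        by (simp add: V VX XV X)
      also have "\<dots> = diag (\<chi> i. 1 - (c $ i)\<^sup>2)"
        by (simp add: diag_mult_diag) (simp add: diag_def mat_def vec_eq_iff power2_eq_square)
      finally show ?thesis .
    qed
    have XT: "transpose X ** (U ** diag d) = 0"
    proof -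
      have "transpose X ** (U ** diag \<sigma>) = transpose X ** G ** R"
        unfolding G by (simp add: matrix_mul_assoc mult_orthogonal_cancel[OF R])
      also have "\<dots> = 0" unfolding tan by (simp add: vec_eq_iff matrix_matrix_mult_def)
      finally have "column i X \<bullet> column j (U ** diag \<sigma>) = 0" for i j by (metis gram_entry zero_index)
      then have z: "\<sigma> $ j = 0 \<or> column i X \<bullet> column j U = 0" for i j by (simp add: column_mult_diag)
      have "column i X \<bullet> column j (U ** diag d) = 0" for i j
        using z[of j i] by (auto simp: column_mult_diag d_def)
      then show ?thesis by (simp add: vec_eq_iff gram_entry)
    qed
    have "V ** diag \<rho> = N ** diag \<rho> + X ** (diag c ** diag \<rho>)"
      by (simp add: N_def matrix_mult_diff_left matrix_mul_assoc)
    then have "inner (V ** diag \<rho> ** R) (U ** diag d) = inner (N ** diag \<rho> ** R) (U ** diag d)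
       + inner (X ** (diag c ** diag \<rho> ** R)) (U ** diag d)"
      by (simp add: matrix_mult_add_left inner_add_left matrix_mul_assoc)
    also have "inner (X ** (diag c ** diag \<rho> ** R)) (U ** diag d) = 0"
      by (simp only: inner_matrix_mult_left XT inner_zero_right)
    finally have "inner (V ** diag \<rho> ** R) (U ** diag d) = inner (N ** diag \<rho> ** R) (U ** diag d)" by simp
    moreover have "inner (V ** diag \<rho>) T = inner (V ** diag \<rho> ** R) (U ** diag d)"
      by (simp only: T_def d_def[symmetric] inner_matrix_mult_right[of "V ** diag \<rho>" R])
    moreover have "inner (N ** diag \<rho> ** R) (U ** diag d) \<le> \<theta> * (\<Sum>j\<in>UNIV. d $ j)"
    proof (rule inner_le_sum_of_columns[OF U])
      fix j
      show "0 \<le> d $ j" using minus_sin_bounds[OF \<sigma>0] by (simp add: d_def)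
      have "(norm (N *v (diag \<rho> *v column j R)))\<^sup>2 = (\<Sum>i\<in>UNIV. (1 - (c $ i)\<^sup>2) * (\<rho> $ i)\<^sup>2 * (R $ i $ j)\<^sup>2)"
        unfolding norm_mult_vec_of_diag_gram[OF gramN]
        by (simp add: diag_mult_vec column_def power_mult_distrib mult.assoc)
      also have "\<dots> \<le> (\<Sum>i\<in>UNIV. \<theta>\<^sup>2 * (R $ i $ j)\<^sup>2)"
      proof (intro sum_mono mult_right_mono)
        fix i
        have "1 - (c $ i)\<^sup>2 = (sin (arccos (c $ i)))\<^sup>2" by (simp add: sin_squared_eq angle)
        then have "(1 - (c $ i)\<^sup>2) * (\<rho> $ i)\<^sup>2 = (angle_ratio (arccos (c $ i)) * sin (arccos (c $ i)))\<^sup>2"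
          by (simp add: \<rho>_def power_mult_distrib)
        also have "\<dots> = (arccos (c $ i))\<^sup>2" using angle by (simp add: angle_ratio_times_sin)
        also have "\<dots> \<le> \<theta>\<^sup>2" using angle c\<theta> by (intro power_mono)
        finally show "(1 - (c $ i)\<^sup>2) * (\<rho> $ i)\<^sup>2 \<le> \<theta>\<^sup>2" .
      qed simp
      also have "\<dots> = \<theta>\<^sup>2" by (simp add: orthogonal_matrix_sums[OF R] flip: sum_distrib_left)
      finally have "norm (N *v (diag \<rho> *v column j R)) \<le> \<theta>" by (rule power2_le_imp_le[OF _ \<theta>(1)])
      then show "norm (column j (N ** diag \<rho> ** R)) \<le> \<theta>"
        by (simp add: column_mult matrix_vector_mul_assoc)
    qed
    moreover have "\<theta> * (\<Sum>j\<in>UNIV. d $ j) \<le> \<theta> * (u / 12 * (norm G)\<^sup>2)"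
      unfolding normG sum_distrib_left
    proof (rule sum_mono)
      fix j
      have "d $ j \<le> \<sigma> $ j * (\<sigma> $ j)\<^sup>2 / 6"
        using minus_sin_bounds[OF \<sigma>0] by (simp add: d_def power3_eq_cube power2_eq_square mult.assoc)
      also have "\<dots> \<le> (u / 2) * (\<sigma> $ j)\<^sup>2 / 6"
        using \<sigma>[of j] by (intro divide_right_mono mult_right_mono) (auto simp: u_def)
      finally show "\<theta> * d $ j \<le> \<theta> * (u / 12 * (\<sigma> $ j)\<^sup>2)"
        using \<theta> by (intro mult_left_mono) auto
    qed
    ultimately show ?thesis by (simp add: mult.assoc)
  qed
  ultimately have "(\<Sum>i\<in>UNIV. (arccos (s $ i))\<^sup>2) \<le> (\<Sum>i\<in>UNIV. (arccos (c $ i))\<^sup>2)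
     - 2 * inner (V ** diag \<rho>) G + (norm G)\<^sup>2 + curvature_const u * (norm G)\<^sup>2 + 2 * (\<theta> * u / 12 * (norm G)\<^sup>2)"
    by simp
  then show ?thesis unfolding u_def by (simp add: algebra_simps)
qed

section \<open>The gradient and the eigenvalue gap\<close>

definition tangent_part :: "real^'n^'n \<Rightarrow> real^'k^'n \<Rightarrow> real^'k^'n" where
  "tangent_part A X = (mat 1 - X ** transpose X) ** A ** X"

lemma rgrad_tangent_part: "rgrad A X = (-2) *\<^sub>R tangent_part A X"
  by (simp add: rgrad_def tangent_part_def)

lemma tangent_part_mult_orthogonal:
  assumes "orthogonal_matrix Q"
  shows "tangent_part A (X ** Q) = tangent_part A X ** Q"
proof -
  have "(X ** Q) ** transpose (X ** Q) = X ** transpose X"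
    by (simp add: matrix_transpose_mul matrix_mul_assoc mult_orthogonal_cancel[OF assms])
  then show ?thesis by (simp add: tangent_part_def matrix_mul_assoc)
qed

lemma norm_residual:
  fixes X :: "real^'k^'n"
  assumes "transpose X ** X = mat 1"
  shows "(norm ((mat 1 - X ** transpose X) *v x))\<^sup>2 = (norm x)\<^sup>2 - (norm (transpose X *v x))\<^sup>2"
proof -
  define z where "z = transpose X *v x"
  have "(mat 1 - X ** transpose X) *v x = x - X *v z"
    by (simp add: z_def matrix_vector_mult_diff_rdistrib matrix_vector_mul_assoc del: transpose_matrix_vector)
  moreover have "(X *v z) \<bullet> x = z \<bullet> z" by (simp only: inner_mult_vec z_def)
  moreover have "(norm (X *v z))\<^sup>2 = z \<bullet> z" by (simp only: norm_orthonormal_mult_vec[OF assms] power2_norm_eq_inner)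
  moreover have "(norm (x - X *v z))\<^sup>2 = (norm x)\<^sup>2 - 2 * ((X *v z) \<bullet> x) + (norm (X *v z))\<^sup>2"
    unfolding power2_norm_eq_inner by (simp only: inner_diff_left inner_diff_right inner_commute[of x "X *v z"])
  ultimately show ?thesis by (simp only: z_def[symmetric] power2_norm_eq_inner)
qed

lemma norm_residual_le:
  fixes X :: "real^'k^'n" and M :: "real^'m^'n"
  assumes "transpose X ** X = mat 1"
  shows "norm ((mat 1 - X ** transpose X) *v x) \<le> norm x"
    and "norm ((mat 1 - X ** transpose X) ** M) \<le> norm M"
proof -
  have *: "(norm ((mat 1 - X ** transpose X) *v x))\<^sup>2 \<le> (norm x)\<^sup>2" for x
    unfolding norm_residual[OF assms] by (simp del: transpose_matrix_vector)
  from *[of x] show "norm ((mat 1 - X ** transpose X) *v x) \<le> norm x" by (rule power2_le_imp_le) simp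
  have "(norm ((mat 1 - X ** transpose X) ** M))\<^sup>2 \<le> (norm M)\<^sup>2"
    unfolding norm_matrix_columns[of M] norm_matrix_columns[of "_ ** M"] column_mult by (intro sum_mono *)
  then show "norm ((mat 1 - X ** transpose X) ** M) \<le> norm M" by (rule power2_le_imp_le) simp
qed

lemma residual_mult_self:
  fixes X :: "real^'k^'n"
  assumes "transpose X ** X = mat 1"
  shows "(mat 1 - X ** transpose X) ** X = 0"
  by (simp add: matrix_mult_diff_left matrix_mul_assoc[symmetric] assms)

text \<open>
  Cauchy-Schwarz for \<open>sqrt (\<alpha> p) + sqrt (\<beta> q)\<close>, without square roots.
\<close>

lemma square_sum_le_of_products:
  fixes f g \<alpha> \<beta> p q :: real
  assumes "f\<^sup>2 \<le> \<alpha> * p" "g\<^sup>2 \<le> \<beta> * q" "0 \<le> \<alpha>" "0 \<le> \<beta>" "0 \<le> p" "0 \<le> q"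
  shows "(f + g)\<^sup>2 \<le> (\<alpha> + \<beta>) * (p + q)"
proof -
  have "(2 * (f * g))\<^sup>2 = 4 * (f\<^sup>2 * g\<^sup>2)" by (simp add: power_mult_distrib)
  also have "\<dots> \<le> 4 * ((\<alpha> * p) * (\<beta> * q))"
    using assms by (intro mult_left_mono mult_mono) auto
  also have "\<dots> \<le> (\<alpha> * q + \<beta> * p)\<^sup>2"
    using sum_squares_bound[of "\<alpha> * q" "\<beta> * p"] by (simp add: power2_sum algebra_simps)
  finally have "2 * (f * g) \<le> \<alpha> * q + \<beta> * p"
    by (rule power2_le_imp_le) (use assms in simp)
  then show ?thesis using assms by (simp add: power2_sum algebra_simps)
qed

text \<open>
  An eigenbasis of \<open>A\<close> split by \<open>K\<close> into leading and trailing eigenvectors, with bounds for the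
  eigenvalues in both groups. Indexing the basis by the coordinates of the space makes it an
  orthogonal matrix.
\<close>

locale split_eigenbasis =
  fixes A :: "real^'n^'n" and w :: "'n \<Rightarrow> real^'n" and \<mu> :: "'n \<Rightarrow> real" and K :: "'n set"
    and top upper lower bottom :: real
  assumes symmetric: "transpose A = A"
    and orthonormal: "w i \<bullet> w j = (if i = j then 1 else 0)"
    and eigenvector: "A *v w i = \<mu> i *\<^sub>R w i"
    and leading: "i \<in> K \<Longrightarrow> upper \<le> \<mu> i" "i \<in> K \<Longrightarrow> \<mu> i \<le> top"
    and trailing: "i \<notin> K \<Longrightarrow> bottom \<le> \<mu> i" "i \<notin> K \<Longrightarrow> \<mu> i \<le> lower"
    and ordered_bounds: "bottom \<le> lower" "lower \<le> upper" "upper \<le> top"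
begin

definition W :: "real^'n^'n" where "W = matrix_of_columns w"

lemma W_orthogonal: "orthogonal_matrix W"
  by (simp add: W_def orthogonal_matrix orthonormal_columns_iff orthonormal)

lemma W_coordinates: "(transpose W *v x) $ i = w i \<bullet> x"
  by (simp add: W_def matrix_of_columns_def matrix_vector_mult_def transpose_def inner_vec_def
      del: transpose_matrix_vector)

lemma inner_coordinates: "x \<bullet> y = (\<Sum>i\<in>UNIV. (w i \<bullet> x) * (w i \<bullet> y))"
proof -
  have "(transpose W *v x) \<bullet> (transpose W *v y) = x \<bullet> ((W ** transpose W) *v y)"
    by (simp only: inner_mult_vec[of "transpose W"] transpose_transpose matrix_vector_mul_assoc)
  then have "x \<bullet> y = (transpose W *v x) \<bullet> (transpose W *v y)"
    using W_orthogonal by (simp add: orthogonal_matrix_def del: transpose_matrix_vector)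
  then show ?thesis by (simp add: inner_vec_def[of "transpose W *v x"] W_coordinates del: transpose_matrix_vector)
qed

lemma norm_coordinates: "(norm x)\<^sup>2 = (\<Sum>i\<in>UNIV. (w i \<bullet> x)\<^sup>2)"
  unfolding power2_norm_eq_inner inner_coordinates[of x x] by (simp only: power2_eq_square)

lemma norm_eigenvector: "norm (w i) = 1"
  by (simp add: norm_eq_1 orthonormal)

lemma image_coordinates: "w i \<bullet> (A *v x) = \<mu> i * (w i \<bullet> x)"
  using inner_mult_vec[of A "w i" x] by (simp add: symmetric eigenvector del: transpose_matrix_vector)

lemma form_coordinates: "x \<bullet> (A *v y) = (\<Sum>i\<in>UNIV. \<mu> i * ((w i \<bullet> x) * (w i \<bullet> y)))"
  by (simp add: inner_coordinates[of x] image_coordinates mult.left_commute)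

lemma A_diagonalized: "A = W ** diag (\<chi> i. \<mu> i) ** transpose W"
proof -
  have "A ** W = W ** diag (\<chi> i. \<mu> i)"
    by (rule matrix_eq_columnsI)
      (simp add: column_mult column_diag matrix_vector_mult_scaleR matrix_vector_mult_basis W_def eigenvector)
  then show ?thesis using mult_orthogonal_cancel(1)[OF W_orthogonal, of A] by simp
qed

text \<open>
  Multiples of the identity have no tangential part, so \<open>A\<close> may be shifted by the midpoint of its
  spectrum, which halves the bound.
\<close>

lemma norm_tangent_part_mult_vec:
  fixes X :: "real^'k^'n"
  assumes X: "transpose X ** X = mat 1"
  shows "norm (tangent_part A X *v y) \<le> (top - bottom) / 2 * norm y"
proof -
  define m where "m = (top + bottom) / 2"
  define x where "x = X *v y"
  have "tangent_part A X *v y = (mat 1 - X ** transpose X) *v (A *v x)"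
    by (simp add: tangent_part_def x_def matrix_vector_mul_assoc matrix_mul_assoc)
  moreover have "(mat 1 - X ** transpose X) *v (m *\<^sub>R x) = 0"
    by (simp only: matrix_vector_mult_scaleR x_def matrix_vector_mul_assoc residual_mult_self[OF X]) simp
  ultimately have "tangent_part A X *v y = (mat 1 - X ** transpose X) *v (A *v x - m *\<^sub>R x)"
    by (simp only: matrix_vector_mult_diff_distrib) simp
  then have "norm (tangent_part A X *v y) \<le> norm (A *v x - m *\<^sub>R x)"
    using norm_residual_le(1)[OF X] by simp
  also have "\<dots> \<le> (top - bottom) / 2 * norm x"
  proof (rule power2_le_imp_le)
    have "(norm (A *v x - m *\<^sub>R x))\<^sup>2 = (\<Sum>i\<in>UNIV. (\<mu> i - m)\<^sup>2 * (w i \<bullet> x)\<^sup>2)"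
      by (simp add: norm_coordinates inner_diff_right image_coordinates flip: left_diff_distrib power_mult_distrib)
    also have "\<dots> \<le> (\<Sum>i\<in>UNIV. ((top - bottom) / 2)\<^sup>2 * (w i \<bullet> x)\<^sup>2)"
    proof (intro sum_mono mult_right_mono)
      fix i
      have "\<bar>\<mu> i - m\<bar> \<le> (top - bottom) / 2"
        using leading[of i] trailing[of i] ordered_bounds by (cases "i \<in> K") (simp_all add: m_def abs_le_iff field_simps)
      then have "\<bar>\<mu> i - m\<bar>\<^sup>2 \<le> ((top - bottom) / 2)\<^sup>2" by (rule power_mono) simp
      then show "(\<mu> i - m)\<^sup>2 \<le> ((top - bottom) / 2)\<^sup>2" by simp
    qed simp
    also have "\<dots> = ((top - bottom) / 2 * norm x)\<^sup>2"
      by (simp only: power_mult_distrib norm_coordinates[of x] sum_distrib_left)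
    finally show "(norm (A *v x - m *\<^sub>R x))\<^sup>2 \<le> ((top - bottom) / 2 * norm x)\<^sup>2" .
  qed (use ordered_bounds in simp)
  also have "norm x = norm y" by (simp add: x_def norm_orthonormal_mult_vec[OF X])
  finally show ?thesis .
qed

end

text \<open>
  A point \<open>X\<close> and the leading eigenspace \<open>V\<close> in principal position, the cosines of the principal
  angles being \<open>c\<close>.
\<close>

locale principal_pair = split_eigenbasis A w \<mu> K top upper lower bottom
  for A :: "real^'n^'n" and w \<mu> K top upper lower bottom +
  fixes X V :: "real^'k^'n" and c :: "real^'k"
  assumes X: "transpose X ** X = mat 1" and V: "transpose V ** V = mat 1"
    and VX: "transpose V ** X = diag c"
    and span_V: "span (columns V) = span (w ` K)"
    and c: "\<And>j. 0 \<le> c $ j" "\<And>j. c $ j \<le> 1"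
begin

abbreviation "xc j \<equiv> column j X"
abbreviation "vc j \<equiv> column j V"

text \<open>
  The contributions of the principal pairs to the suboptimality \<open>cost A X - cost A V\<close>.
\<close>

definition energy_gap :: "'k \<Rightarrow> real" where
  "energy_gap j = vc j \<bullet> (A *v vc j) - xc j \<bullet> (A *v xc j)"

lemma unit_columns: "vc j \<bullet> vc j = 1" "xc j \<bullet> xc j = 1"
  using X V by (auto simp: orthonormal_columns_iff)

lemma vc_xc: "vc i \<bullet> xc j = (if i = j then c $ j else 0)"
  by (simp add: gram_entry[symmetric] VX) (simp add: diag_def)

lemma vc_trailing: "i \<notin> K \<Longrightarrow> w i \<bullet> vc j = 0"
proof -
  assume i: "i \<notin> K"
  have "vc j \<in> span (w ` K)" unfolding span_V[symmetric] by (rule span_base) (auto simp: columns_def)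
  then show "w i \<bullet> vc j = 0"
  proof (induction rule: span_induct)
    case base show ?case by (simp add: subspace_def inner_add_right)
  next
    case (step y) then show ?case using i by (auto simp: orthonormal)
  qed
qed

text \<open>
  The component of a principal vector of \<open>X\<close> orthogonal to the leading eigenspace; its length is
  the sine of the principal angle.
\<close>

definition normal_part :: "'k \<Rightarrow> real^'n" where
  "normal_part j = xc j - c $ j *\<^sub>R vc j"

lemma vc_normal_part: "vc i \<bullet> normal_part j = 0"
  using V by (simp add: normal_part_def inner_diff_right vc_xc orthonormal_columns_iff)

lemma normal_part_leading: "i \<in> K \<Longrightarrow> w i \<bullet> normal_part j = 0"
proof -
  assume "i \<in> K"
  then have "w i \<in> span (columns V)" unfolding span_V by (auto intro: span_base)
  then show "w i \<bullet> normal_part j = 0"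
  proof (induction rule: span_induct)
    case base show ?case by (simp add: subspace_def inner_add_left)
  next
    case (step y) then show ?case by (auto simp: columns_def vc_normal_part)
  qed
qed

lemma form_vc_normal_part: "vc i \<bullet> (A *v normal_part j) = 0" "normal_part j \<bullet> (A *v vc i) = 0"
  unfolding form_coordinates
  by (rule sum.neutral, metis vc_trailing normal_part_leading mult_zero_left mult_zero_right)+

lemma xc_split: "xc j = c $ j *\<^sub>R vc j + normal_part j"
  by (simp add: normal_part_def)

lemma norm_normal_part: "(norm (normal_part j))\<^sup>2 = 1 - (c $ j)\<^sup>2"
  unfolding power2_norm_eq_inner
  by (simp only: normal_part_def inner_diff_left inner_diff_right inner_scaleR_left inner_scaleR_right
      unit_columns vc_xc inner_commute[of "xc j" "vc j"]) (simp add: power2_eq_square)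

lemma form_vc_xc: "vc j \<bullet> (A *v xc j) = c $ j * (vc j \<bullet> (A *v vc j))"
  by (subst xc_split) (simp add: matrix_vector_right_distrib matrix_vector_mult_scaleR inner_add_right form_vc_normal_part)

text \<open>
  The quadratic growth of the cost. As the leading eigenspace is invariant, no mixed terms occur, and
  moving the fraction \<open>1 - c\<^sup>2\<close> of a unit vector to the trailing eigenspace costs at least the
  eigenvalue gap.
\<close>

lemma energy_gap_ge: "(upper - lower) * (1 - (c $ j)\<^sup>2) \<le> energy_gap j"
proof -
  have "xc j \<bullet> (A *v xc j) = (c $ j)\<^sup>2 * (vc j \<bullet> (A *v vc j)) + normal_part j \<bullet> (A *v normal_part j)"
    unfolding xc_split[of j]
    by (simp add: matrix_vector_right_distrib matrix_vector_mult_scaleR inner_add_right inner_add_left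
        form_vc_normal_part power2_eq_square)
  then have gap: "energy_gap j = (1 - (c $ j)\<^sup>2) * (vc j \<bullet> (A *v vc j)) - normal_part j \<bullet> (A *v normal_part j)"
    by (simp add: energy_gap_def algebra_simps)
  have "upper * (vc j \<bullet> vc j) \<le> vc j \<bullet> (A *v vc j)"
    unfolding form_coordinates inner_coordinates[of "vc j" "vc j"] sum_distrib_left
  proof (rule sum_mono)
    fix i show "upper * ((w i \<bullet> vc j) * (w i \<bullet> vc j)) \<le> \<mu> i * ((w i \<bullet> vc j) * (w i \<bullet> vc j))"
      using leading(1)[of i] vc_trailing[of i j] by (cases "i \<in> K") (auto intro: mult_right_mono)
  qed
  then have 1: "upper \<le> vc j \<bullet> (A *v vc j)" by (simp only: unit_columns mult_1_right)
  have "normal_part j \<bullet> (A *v normal_part j) \<le> lower * (normal_part j \<bullet> normal_part j)"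
    unfolding form_coordinates inner_coordinates[of "normal_part j" "normal_part j"] sum_distrib_left
  proof (rule sum_mono)
    fix i show "\<mu> i * ((w i \<bullet> normal_part j) * (w i \<bullet> normal_part j)) \<le> lower * ((w i \<bullet> normal_part j) * (w i \<bullet> normal_part j))"
      using trailing(2)[of i] normal_part_leading[of i j] by (cases "i \<in> K") (auto intro: mult_right_mono)
  qed
  also have "\<dots> = lower * (1 - (c $ j)\<^sup>2)" by (simp only: power2_norm_eq_inner[symmetric] norm_normal_part)
  finally have 2: "normal_part j \<bullet> (A *v normal_part j) \<le> lower * (1 - (c $ j)\<^sup>2)" .
  have "0 \<le> 1 - (c $ j)\<^sup>2" using c[of j] by (simp add: power_le_one)
  from mult_left_mono[OF 1 this] 2 show ?thesis unfolding gap by (simp add: algebra_simps)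
qed

lemma energy_gap_nonneg: "0 \<le> energy_gap j"
proof -
  have "0 \<le> (upper - lower) * (1 - (c $ j)\<^sup>2)"
    using c[of j] ordered_bounds by (simp add: power_le_one)
  then show ?thesis using energy_gap_ge[of j] by simp
qed

text \<open>
  With \<open>d\<close> the angle ratios, this says how well the direction of descent agrees with the direction
  of the leading eigenspace: each pair contributes \<open>\<theta> cot \<theta>\<close> times its share of the suboptimality.
\<close>

lemma inner_tangent_part:
  "inner (V ** diag d) (tangent_part A X) = (\<Sum>j\<in>UNIV. d $ j * (c $ j * energy_gap j))"
proof -
  have "vc j \<bullet> column j (tangent_part A X) = c $ j * energy_gap j" for j
  proof -
    have col: "column j (tangent_part A X) = A *v xc j - X *v (transpose X *v (A *v xc j))"
      by (simp add: tangent_part_def column_mult matrix_mul_assoc[symmetric] matrix_vector_mult_diff_rdistrib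
          matrix_vector_mul_assoc[symmetric] del: transpose_matrix_vector)
    have proj: "vc j \<bullet> (X *v (transpose X *v y)) = c $ j * (xc j \<bullet> y)" for y
    proof -
      have "transpose X *v vc j = c $ j *\<^sub>R axis j 1"
      proof -
        have "(transpose X *v vc j) $ i = vc j \<bullet> xc i" for i
          by (simp add: matrix_vector_mult_def transpose_def inner_vec_def column_def mult.commute
              del: transpose_matrix_vector)
        then show ?thesis by (simp add: vec_eq_iff vc_xc axis_def del: transpose_matrix_vector)
      qed
      then have "X *v (transpose X *v vc j) = c $ j *\<^sub>R xc j"
        by (simp only: matrix_vector_mult_scaleR matrix_vector_mult_basis)
      moreover have "vc j \<bullet> (X *v (transpose X *v y)) = (X *v (transpose X *v vc j)) \<bullet> y"
        by (simp only: inner_mult_vec[of X] inner_mult_vec[of "transpose X"] transpose_transpose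
            inner_commute[of "vc j"])
      ultimately show ?thesis by simp
    qed
    show ?thesis
      by (simp only: col inner_diff_right proj form_vc_xc energy_gap_def right_diff_distrib)
  qed
  then show ?thesis by (simp add: inner_matrix_columns column_mult_diag)
qed

text \<open>
  The squared lengths of the projections of the eigenvectors distribute a total mass of the subspace
  dimension over the eigenbasis. For \<open>V\<close> the mass sits on \<open>K\<close>.
\<close>

lemma weight_V: "(norm (transpose V *v w i))\<^sup>2 = (if i \<in> K then 1 else 0)"
proof (cases "i \<in> K")
  case True
  then have "w i \<in> span (columns V)" unfolding span_V by (auto intro: span_base)
  then have "norm (V *v (transpose V *v w i)) = norm (w i)"
    by (simp only: projection_onto_span_columns[OF V])
  then show ?thesis using True
    by (simp add: norm_orthonormal_mult_vec[OF V] norm_eigenvector del: transpose_matrix_vector)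
next
  case False
  have "(transpose V *v w i) $ j = w i \<bullet> vc j" for j
    by (simp add: matrix_vector_mult_def transpose_def inner_vec_def column_def mult.commute
        del: transpose_matrix_vector)
  then show ?thesis using False vc_trailing
    by (simp add: norm_vec_square del: transpose_matrix_vector)
qed

lemma column_coordinates: "(norm (transpose M *v w i))\<^sup>2 = (\<Sum>j\<in>UNIV. (w i \<bullet> column j M)\<^sup>2)" for M :: "real^'k^'n"
proof -
  have "(transpose M *v w i) $ j = w i \<bullet> column j M" for j
    by (simp add: matrix_vector_mult_def transpose_def inner_vec_def column_def mult.commute
        del: transpose_matrix_vector)
  then show ?thesis by (simp add: norm_vec_square del: transpose_matrix_vector)
qed

lemma weighted_energy:
  "(\<Sum>j\<in>UNIV. column j M \<bullet> (A *v column j M)) = (\<Sum>i\<in>UNIV. \<mu> i * (norm (transpose M *v w i))\<^sup>2)"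
  for M :: "real^'k^'n"
  unfolding form_coordinates column_coordinates sum_distrib_left
  by (subst sum.swap) (simp add: power2_eq_square del: transpose_matrix_vector)

lemma total_weight:
  fixes M :: "real^'k^'n"
  assumes "transpose M ** M = mat 1"
  shows "(\<Sum>i\<in>UNIV. (norm (transpose M *v w i))\<^sup>2) = real CARD('k)"
proof -
  have "(\<Sum>i\<in>UNIV. (norm (transpose M *v w i))\<^sup>2) = (\<Sum>i\<in>UNIV. \<Sum>j\<in>UNIV. (w i \<bullet> column j M)\<^sup>2)"
    by (simp only: column_coordinates)
  also have "\<dots> = (\<Sum>j\<in>UNIV. \<Sum>i\<in>UNIV. (w i \<bullet> column j M)\<^sup>2)" by (rule sum.swap)
  also have "\<dots> = (\<Sum>j\<in>UNIV. (norm (column j M))\<^sup>2)" by (simp only: norm_coordinates)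
  also have "\<dots> = (\<Sum>j\<in>(UNIV :: 'k set). 1)"
    using assms by (intro sum.cong refl) (simp add: orthonormal_columns_iff norm_eq_1[THEN iffD2])
  finally show ?thesis by simp
qed

text \<open>
  The usual bound of the squared gradient by the suboptimality, for a function with smoothness constant
  \<open>2 (top - bottom)\<close>. Write \<open>A = lower + P1 - P2\<close> with positive semidefinite \<open>P1\<close>, \<open>P2\<close> supported on
  the leading and trailing eigenspaces. Then the suboptimality is \<open>p + q\<close>, the \<open>P1\<close>-energy outside
  \<open>X\<close> plus the \<open>P2\<close>-energy inside, and the two parts of the gradient are controlled by \<open>p\<close> and \<open>q\<close>
  separately.
\<close>

lemma norm_tangent_part: "(norm (tangent_part A X))\<^sup>2 \<le> (top - bottom) * (\<Sum>j\<in>UNIV. energy_gap j)"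
proof -
  define wt where "wt i = (norm (transpose X *v w i))\<^sup>2" for i
  define a where "a i = (if i \<in> K then \<mu> i - lower else 0)" for i
  define b where "b i = (if i \<in> K then 0 else lower - \<mu> i)" for i
  define p where "p = (\<Sum>i\<in>UNIV. a i * (1 - wt i))"
  define q where "q = (\<Sum>i\<in>UNIV. b i * wt i)"
  define Res where "Res = mat 1 - X ** transpose X"
  have wt: "0 \<le> wt i" "wt i \<le> 1" for i
  proof -
    show "0 \<le> wt i" by (simp add: wt_def del: transpose_matrix_vector)
    show "wt i \<le> 1" using norm_transpose_mult_vec_le[OF X, of "w i"] unfolding wt_def
      by (simp add: norm_eigenvector power_le_one del: transpose_matrix_vector)
  qed
  have a: "0 \<le> a i" "a i \<le> top - lower" for i
    using leading[of i] ordered_bounds by (auto simp: a_def)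
  have b: "0 \<le> b i" "b i \<le> lower - bottom" for i
    using trailing[of i] ordered_bounds by (auto simp: b_def)
  have gap: "(\<Sum>j\<in>UNIV. energy_gap j) = p + q"
  proof -
    have "(\<Sum>j\<in>UNIV. energy_gap j) = (\<Sum>i\<in>UNIV. \<mu> i * (if i \<in> K then 1 else 0)) - (\<Sum>i\<in>UNIV. \<mu> i * wt i)"
      unfolding energy_gap_def sum_subtractf weighted_energy weight_V wt_def ..
    \<comment> \<open>Equal total masses allow the shift of all eigenvalues by \<open>lower\<close>.\<close>
    moreover have "(\<Sum>i\<in>UNIV. wt i) = (\<Sum>i\<in>UNIV. (if i \<in> K then 1 else 0))"
      using total_weight[OF X] total_weight[OF V] unfolding weight_V wt_def by simp
    then have "lower * (\<Sum>i\<in>UNIV. wt i) = lower * (\<Sum>i\<in>UNIV. (if i \<in> K then 1 else 0))" by simp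
    moreover have "p + q = (\<Sum>i\<in>UNIV. \<mu> i * (if i \<in> K then 1 else 0)) - (\<Sum>i\<in>UNIV. \<mu> i * wt i)
       - lower * (\<Sum>i\<in>UNIV. (if i \<in> K then 1 else 0)) + lower * (\<Sum>i\<in>UNIV. wt i)"
      unfolding p_def q_def sum_distrib_left sum_subtractf[symmetric] sum.distrib[symmetric]
      by (rule sum.cong) (auto simp: a_def b_def algebra_simps)
    ultimately show ?thesis by simp
  qed
  define P1 P2 where "P1 = W ** diag (\<chi> i. a i) ** transpose W" and "P2 = W ** diag (\<chi> i. b i) ** transpose W"
  have "diag (\<chi> i. \<mu> i) = lower *\<^sub>R mat 1 + diag (\<chi> i. a i) - diag (\<chi> i. b i)"
    by (simp add: diag_def mat_def vec_eq_iff a_def b_def)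
  then have "A = lower *\<^sub>R (W ** transpose W) + P1 - P2"
    by (subst A_diagonalized) (simp add: P1_def P2_def matrix_mult_add_left matrix_mult_add_right
        matrix_mult_diff_left matrix_mult_diff_right matrix_mult_scaleR_right scalar_matrix_assoc[symmetric])
  then have A: "A = lower *\<^sub>R mat 1 + P1 - P2" using W_orthogonal by (simp add: orthogonal_matrix_def)
  have "tangent_part A X = lower *\<^sub>R (Res ** X) + Res ** P1 ** X - Res ** (P2 ** X)"
    unfolding tangent_part_def Res_def[symmetric] A
    by (simp add: matrix_mult_add_left matrix_mult_add_right matrix_mult_diff_left matrix_mult_diff_right
        matrix_mult_scaleR_right scalar_matrix_assoc[symmetric] matrix_mul_assoc)
  then have split: "tangent_part A X = Res ** P1 ** X - Res ** (P2 ** X)"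
    using residual_mult_self[OF X] by (simp add: Res_def)
  have f: "(norm (Res ** P1 ** X))\<^sup>2 \<le> (top - lower) * p"
  proof -
    have "Res ** P1 = (Res ** W ** diag (\<chi> i. a i)) ** transpose W"
      by (simp add: P1_def matrix_mul_assoc)
    then have "norm (Res ** P1) = norm (Res ** W ** diag (\<chi> i. a i))"
      using W_orthogonal by (simp add: norm_mult_orthogonal)
    then have "norm (Res ** P1 ** X) \<le> norm (Res ** W ** diag (\<chi> i. a i))"
      using norm_mult_orthonormal_le[OF X, of "Res ** P1"] by simp
    then have "(norm (Res ** P1 ** X))\<^sup>2 \<le> (norm (Res ** W ** diag (\<chi> i. a i)))\<^sup>2"
      by (rule power_mono) simp
    also have "\<dots> = (\<Sum>i\<in>UNIV. (a i)\<^sup>2 * (1 - wt i))"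
    proof -
      have "(norm (Res *v w i))\<^sup>2 = 1 - wt i" for i
        unfolding Res_def norm_residual[OF X] by (simp add: norm_eigenvector wt_def del: transpose_matrix_vector)
      then show ?thesis
        unfolding norm_matrix_columns by (simp add: column_mult_diag power_mult_distrib) (simp add: column_mult W_def)
    qed
    also have "\<dots> \<le> (\<Sum>i\<in>UNIV. (top - lower) * (a i * (1 - wt i)))"
    proof (rule sum_mono)
      fix i
      have "a i * (a i * (1 - wt i)) \<le> (top - lower) * (a i * (1 - wt i))"
        using a[of i] wt[of i] by (intro mult_right_mono) auto
      then show "(a i)\<^sup>2 * (1 - wt i) \<le> (top - lower) * (a i * (1 - wt i))" by (simp add: power2_eq_square mult.assoc)
    qed
    finally show ?thesis by (simp only: p_def sum_distrib_left)
  qed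
  have g: "(norm (Res ** (P2 ** X)))\<^sup>2 \<le> (lower - bottom) * q"
  proof -
    have "P2 ** X = W ** (diag (\<chi> i. b i) ** (transpose W ** X))"
      by (simp add: P2_def matrix_mul_assoc)
    then have "norm (P2 ** X) = norm (diag (\<chi> i. b i) ** (transpose W ** X))"
      using W_orthogonal by (simp only: norm_orthonormal_mult orthogonal_matrix)
    also have "\<dots> = norm (transpose X ** W ** diag (\<chi> i. b i))"
      by (subst norm_transpose[symmetric]) (simp add: matrix_transpose_mul transpose_diag matrix_mul_assoc)
    finally have "norm (Res ** (P2 ** X)) \<le> norm (transpose X ** W ** diag (\<chi> i. b i))"
      using norm_residual_le(2)[OF X, of "P2 ** X"] by (simp add: Res_def)
    then have "(norm (Res ** (P2 ** X)))\<^sup>2 \<le> (norm (transpose X ** W ** diag (\<chi> i. b i)))\<^sup>2"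
      by (rule power_mono) simp
    also have "\<dots> = (\<Sum>i\<in>UNIV. (b i)\<^sup>2 * wt i)"
      unfolding norm_matrix_columns
      by (simp add: column_mult_diag power_mult_distrib)
        (simp add: column_mult W_def wt_def del: transpose_matrix_vector)
    also have "\<dots> \<le> (\<Sum>i\<in>UNIV. (lower - bottom) * (b i * wt i))"
    proof (rule sum_mono)
      fix i
      have "b i * (b i * wt i) \<le> (lower - bottom) * (b i * wt i)"
        using b[of i] wt[of i] by (intro mult_right_mono) auto
      then show "(b i)\<^sup>2 * wt i \<le> (lower - bottom) * (b i * wt i)" by (simp add: power2_eq_square mult.assoc)
    qed
    finally show ?thesis by (simp only: q_def sum_distrib_left)
  qed
  have pq: "0 \<le> p" "0 \<le> q"
    unfolding p_def q_def using a b wt by (auto intro!: sum_nonneg mult_nonneg_nonneg)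
  have "norm (tangent_part A X) \<le> norm (Res ** P1 ** X) + norm (Res ** (P2 ** X))"
    unfolding split by (rule norm_triangle_ineq4)
  then have "(norm (tangent_part A X))\<^sup>2 \<le> (norm (Res ** P1 ** X) + norm (Res ** (P2 ** X)))\<^sup>2"
    by (rule power_mono) simp
  also have "\<dots> \<le> ((top - lower) + (lower - bottom)) * (p + q)"
    using f g pq ordered_bounds by (intro square_sum_le_of_products) auto
  finally show ?thesis by (simp add: gap)
qed

end

section \<open>Convergence of steepest descent\<close>

context split_eigenbasis
begin

text \<open>
  One step of the method. The linear term of the distance estimate gains \<open>4 \<eta> r cos \<theta>\<close> times the
  suboptimality, \<open>r = \<theta> / sin \<theta>\<close>; the quadratic term costs at most \<open>2 \<eta> C cos \<theta>\<close> times the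
  suboptimality, by the gradient bound and the step size restriction. The budget inequality leaves
  \<open>2 \<eta> cos \<theta> (4/\<pi>\<^sup>2) r\<^sup>2\<close>, and \<open>r\<^sup>2\<close> is exactly what turns the growth bound in terms of \<open>sin\<^sup>2\<close>
  into one in terms of the squared angles. The fixed \<open>\<theta>\<close> only has to dominate the
  current distance, so the initial distance serves for all steps.
\<close>

lemma squared_distance_contracts:
  fixes X1 :: "real^'k^'n"
  assumes X1: "represents X1 S" and T: "T = span (w ` K)" and rep_T: "\<exists>Y :: real^'k^'n. represents Y T"
    and card: "CARD('k) \<le> CARD('n)"
    and dist: "gr_dist TYPE('k) S T \<le> \<theta>" and \<theta>: "0 \<le> \<theta>" "\<theta> \<le> pi/2"
    and \<eta>: "0 \<le> \<eta>" "2 * (top - bottom) * \<eta> \<le> cos \<theta>"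
    and S': "S' = gr_exp X1 (- \<eta> *\<^sub>R rgrad A X1)"
  shows "(gr_dist TYPE('k) S' T)\<^sup>2
    \<le> (1 - 2 * (4 / pi\<^sup>2) * cos \<theta> * (upper - lower) * \<eta>) * (gr_dist TYPE('k) S T)\<^sup>2"
proof -
  have rep_S: "\<exists>X :: real^'k^'n. represents X S" using X1 by blast
  obtain X V :: "real^'k^'n" and c where XV: "represents X S" "represents V T"
    and VX: "transpose V ** X = diag c" and c: "\<And>i. 0 \<le> c $ i" "\<And>i. c $ i \<le> 1"
    and d: "gr_dist TYPE('k) S T = sqrt (\<Sum>i\<in>UNIV. (arccos (c $ i))\<^sup>2)"
    using gr_dist_principal_pairs[OF rep_S rep_T] by metis
  have X: "transpose X ** X = mat 1" and V: "transpose V ** V = mat 1" and span_V: "span (columns V) = span (w ` K)"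
    using XV by (simp_all add: represents_def T)
  interpret principal_pair A w \<mu> K top upper lower bottom X V c
    by unfold_locales (use X V VX span_V c in auto)
  define \<rho> :: "real^'k" where "\<rho> = (\<chi> i. angle_ratio (arccos (c $ i)))"
  define r where "r = angle_ratio \<theta>"
  define F where "F = (\<Sum>i\<in>UNIV. (arccos (c $ i))\<^sup>2)"
  define C where "C = 1 + curvature_const (cos \<theta>) + \<theta> * cos \<theta> / 6"
  define gap where "gap = (\<Sum>j\<in>UNIV. energy_gap j)"
  have angle: "0 \<le> arccos (c $ i)" "arccos (c $ i) \<le> pi/2" "cos (arccos (c $ i)) = c $ i" for i
    using arccos_in_quadrant[OF c(1)[of i] c(2)[of i]] c(1)[of i] c(2)[of i] by auto
  have angle_le: "arccos (c $ i) \<le> \<theta>" for i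
  proof -
    have "(arccos (c $ i))\<^sup>2 \<le> F" unfolding F_def by (rule member_le_sum) auto
    then have "arccos (c $ i) \<le> sqrt F" by (rule real_le_rsqrt)
    then show ?thesis using dist by (simp add: d F_def)
  qed
  \<comment> \<open>The step is taken from \<open>X1\<close>; rotating its decomposition by \<open>Q\<close> describes the same step from \<open>X\<close>.\<close>
  obtain Q where Q: "orthogonal_matrix Q" and X1Q: "X1 = X ** Q"
    using represents_unique_up_to_rotation[OF XV(1) X1] by metis
  define G where "G = - \<eta> *\<^sub>R rgrad A X"
  have G1: "- \<eta> *\<^sub>R rgrad A X1 = G ** Q"
    by (simp add: G_def X1Q rgrad_tangent_part tangent_part_mult_orthogonal[OF Q] scalar_matrix_assoc)
  have G_H: "G = (2 * \<eta>) *\<^sub>R tangent_part A X" by (simp add: G_def rgrad_tangent_part)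
  have tan: "transpose X ** G = 0"
    unfolding G_def matrix_mult_scaleR_right using rgrad_tangent[OF X, of A] by simp
  have X1o: "transpose X1 ** X1 = mat 1" using X1 by (simp add: represents_def)
  have tan1: "transpose X1 ** (G ** Q) = 0"
    unfolding G1[symmetric] matrix_mult_scaleR_right using rgrad_tangent[OF X1o, of A] by simp
  obtain U \<sigma> R where svd1: "compact_svd (G ** Q) U \<sigma> R"
    and Z: "represents (X1 ** R ** diag (\<chi> i. cos (\<sigma> $ i)) + U ** diag (\<chi> i. sin (\<sigma> $ i))) S'"
    using represents_gr_exp[OF X1o tan1 card] unfolding S' G1 by metis
  define R' where "R' = Q ** R"
  have R: "orthogonal_matrix R" using svd1 by (simp add: compact_svd_def)
  then have R': "orthogonal_matrix R'" unfolding R'_def using Q by (rule orthogonal_matrix_mul[rotated])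
  have svd: "compact_svd G U \<sigma> R'"
  proof -
    have "G = G ** Q ** transpose Q" by (simp add: mult_orthogonal_cancel[OF Q])
    also have "G ** Q = U ** diag \<sigma> ** transpose R" using svd1 by (simp add: compact_svd_def)
    also have "U ** diag \<sigma> ** transpose R ** transpose Q = U ** diag \<sigma> ** transpose R'"
      by (simp add: R'_def matrix_transpose_mul matrix_mul_assoc)
    finally show ?thesis using svd1 R' by (simp add: compact_svd_def)
  qed
  define Y where "Y = (X ** R' ** diag (\<chi> i. cos (\<sigma> $ i)) + U ** diag (\<chi> i. sin (\<sigma> $ i))) ** transpose R'"
  have Y: "represents Y S'"
    unfolding Y_def using represents_mult_orthogonal[OF Z, of "transpose R'"] R'
    by (simp add: R'_def X1Q matrix_mul_assoc)
  then have rep_S': "\<exists>X :: real^'k^'n. represents X S'" by blast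
  obtain Y2 V2 :: "real^'k^'n" and s where YV: "represents Y2 S'" "represents V2 T"
    and VY2: "transpose V2 ** Y2 = diag s" and s: "\<And>i. 0 \<le> s $ i" "\<And>i. s $ i \<le> 1"
    and d': "gr_dist TYPE('k) S' T = sqrt (\<Sum>i\<in>UNIV. (arccos (s $ i))\<^sup>2)"
    using gr_dist_principal_pairs[OF rep_S' rep_T] by metis
  \<comment> \<open>The representatives that realize the new distance differ from \<open>V\<close> and \<open>Y\<close> by rotations, which become the singular vectors of \<open>V\<^sup>T Y\<close>.\<close>
  obtain O1 where O1: "orthogonal_matrix O1" and V2: "V2 = V ** O1"
    using represents_unique_up_to_rotation[OF XV(2) YV(2)] by metis
  obtain O2 where O2: "orthogonal_matrix O2" and Y2: "Y2 = Y ** O2"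
    using represents_unique_up_to_rotation[OF Y YV(1)] by metis
  have VY: "transpose V ** Y = O1 ** diag s ** transpose O2"
  proof -
    have "O1 ** diag s ** transpose O2 = (O1 ** transpose O1) ** (transpose V ** (Y ** O2 ** transpose O2))"
      unfolding VY2[symmetric] V2 Y2 by (simp only: matrix_transpose_mul matrix_mul_assoc)
    also have "\<dots> = transpose V ** Y"
      using O1 by (simp only: mult_orthogonal_cancel[OF O2]) (simp add: orthogonal_matrix_def)
    finally show ?thesis by simp
  qed
  have \<sigma>: "\<sigma> $ j \<le> cos \<theta> / 2" for j
  proof -
    have R'1: "transpose R' ** R' = mat 1" and U: "transpose U ** U = mat 1" and \<sigma>0: "0 \<le> \<sigma> $ j"
      and G: "G = U ** diag \<sigma> ** transpose R'"
      using svd R' by (auto simp: compact_svd_def orthogonal_matrix_def)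
    have "G *v column j R' = U *v (diag \<sigma> *v ((transpose R' ** R') *v axis j 1))"
      by (simp only: G matrix_vector_mul_assoc matrix_mul_assoc matrix_vector_mult_basis[symmetric])
    then have "norm (G *v column j R') = norm (diag \<sigma> *v axis j 1)"
      by (simp add: R'1 norm_orthonormal_mult_vec[OF U])
    then have "\<sigma> $ j = norm (G *v column j R')"
      using \<sigma>0 by (simp add: matrix_vector_mult_basis column_diag)
    also have "\<dots> = 2 * \<eta> * norm (tangent_part A X *v column j R')"
      using \<eta>(1) by (simp add: G_H scaleR_matrix_vector_assoc[symmetric])
    also have "\<dots> \<le> 2 * \<eta> * ((top - bottom) / 2 * norm (column j R'))"
      using \<eta>(1) by (intro mult_left_mono norm_tangent_part_mult_vec X) simp
    also have "norm (column j R') = 1"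
      using R'1 by (simp add: orthonormal_columns_iff norm_eq_1)
    finally show ?thesis using \<eta>(2) by (simp add: algebra_simps)
  qed
  have step: "(\<Sum>i\<in>UNIV. (arccos (s $ i))\<^sup>2) \<le> F - 2 * inner (V ** diag \<rho>) G + C * (norm G)\<^sup>2"
    unfolding F_def \<rho>_def C_def
    by (rule squared_distance_after_step[OF X V VX c \<theta> angle_le tan svd \<sigma> Y_def VY O1 O2 s])
  have cos0: "0 \<le> cos \<theta>" "cos \<theta> \<le> 1" using cos_in_unit[OF \<theta>] .
  have C0: "0 \<le> C" using curvature_const_nonneg[OF cos0] \<theta> cos0 by (simp add: C_def)
  have gap0: "0 \<le> gap" unfolding gap_def by (intro sum_nonneg energy_gap_nonneg)
  have linear: "r * cos \<theta> * gap \<le> inner (V ** diag \<rho>) (tangent_part A X)"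
    unfolding inner_tangent_part gap_def sum_distrib_left
  proof (rule sum_mono)
    fix j
    have "r * cos \<theta> \<le> \<rho> $ j * c $ j"
      using angle_ratio_cos_antimono[OF angle(1) angle_le \<theta>(2), of j] by (simp add: r_def \<rho>_def angle)
    then show "r * cos \<theta> * energy_gap j \<le> \<rho> $ j * (c $ j * energy_gap j)"
      using mult_right_mono[OF _ energy_gap_nonneg[of j]] by (simp add: mult.assoc[symmetric])
  qed
  have quadratic: "C * (norm G)\<^sup>2 \<le> 2 * \<eta> * cos \<theta> * C * gap"
  proof -
    have "(norm G)\<^sup>2 = 4 * \<eta>\<^sup>2 * (norm (tangent_part A X))\<^sup>2"
      by (simp add: G_H power_mult_distrib)
    also have "\<dots> \<le> 4 * \<eta>\<^sup>2 * ((top - bottom) * gap)"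
      unfolding gap_def by (intro mult_left_mono norm_tangent_part) simp
    also have "\<dots> = (2 * (top - bottom) * \<eta>) * (2 * \<eta> * gap)" by (simp add: power2_eq_square)
    also have "\<dots> \<le> cos \<theta> * (2 * \<eta> * gap)" using \<eta> gap0 by (intro mult_right_mono) auto
    finally have "(norm G)\<^sup>2 \<le> cos \<theta> * (2 * \<eta> * gap)" .
    from mult_left_mono[OF this C0] show ?thesis by (simp add: mult_ac)
  qed
  have growth: "(upper - lower) * F \<le> r\<^sup>2 * gap"
    unfolding F_def gap_def sum_distrib_left
  proof (rule sum_mono)
    fix j
    have "1 - (c $ j)\<^sup>2 = (sin (arccos (c $ j)))\<^sup>2" by (simp add: sin_squared_eq angle)
    then have "(arccos (c $ j))\<^sup>2 = (\<rho> $ j)\<^sup>2 * (1 - (c $ j)\<^sup>2)"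
      by (simp only: \<rho>_def vec_lambda_beta power_mult_distrib[symmetric] angle_ratio_times_sin[OF angle(1,2)])
    also have "\<dots> \<le> r\<^sup>2 * (1 - (c $ j)\<^sup>2)"
    proof (intro mult_right_mono power_mono)
      show "\<rho> $ j \<le> r" using angle_ratio_mono[OF angle(1) angle_le \<theta>(2), of j] by (simp add: r_def \<rho>_def)
      show "0 \<le> \<rho> $ j" using angle_ratio_ge_one[OF angle(1,2), of j] by (simp add: \<rho>_def)
      show "0 \<le> 1 - (c $ j)\<^sup>2" using c[of j] by (simp add: power_le_one)
    qed
    finally have "(upper - lower) * (arccos (c $ j))\<^sup>2 \<le> (upper - lower) * (r\<^sup>2 * (1 - (c $ j)\<^sup>2))"
      using ordered_bounds by (intro mult_left_mono) auto
    also have "\<dots> = r\<^sup>2 * ((upper - lower) * (1 - (c $ j)\<^sup>2))" by (simp add: mult_ac)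
    also have "\<dots> \<le> r\<^sup>2 * energy_gap j" by (intro mult_left_mono energy_gap_ge) simp
    finally show "(upper - lower) * (arccos (c $ j))\<^sup>2 \<le> r\<^sup>2 * energy_gap j" .
  qed
  have "(\<Sum>i\<in>UNIV. (arccos (s $ i))\<^sup>2) \<le> F - 4 * \<eta> * (r * cos \<theta> * gap) + 2 * \<eta> * cos \<theta> * C * gap"
  proof -
    have "2 * inner (V ** diag \<rho>) G = 4 * \<eta> * inner (V ** diag \<rho>) (tangent_part A X)" by (simp add: G_H)
    then show ?thesis using step quadratic mult_left_mono[OF linear, of "4 * \<eta>"] \<eta>(1) by simp
  qed
  also have "\<dots> = F - 2 * \<eta> * cos \<theta> * gap * (2 * r - C)" by (simp add: algebra_simps)
  also have "\<dots> \<le> F - 2 * \<eta> * cos \<theta> * gap * (4 / pi\<^sup>2 * r\<^sup>2)"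
    using step_budget[OF \<theta>] \<eta>(1) cos0 gap0
    by (intro diff_left_mono mult_left_mono mult_nonneg_nonneg) (auto simp: C_def r_def)
  also have "\<dots> = F - 2 * \<eta> * cos \<theta> * (4 / pi\<^sup>2) * (r\<^sup>2 * gap)" by (simp add: mult_ac)
  also have "\<dots> \<le> F - 2 * \<eta> * cos \<theta> * (4 / pi\<^sup>2) * ((upper - lower) * F)"
    using \<eta>(1) cos0 by (intro diff_left_mono mult_left_mono growth mult_nonneg_nonneg) auto
  also have "\<dots> = (1 - 2 * (4 / pi\<^sup>2) * cos \<theta> * (upper - lower) * \<eta>) * F"
  proof -
    have "F - 2 * \<eta> * cos \<theta> * b * ((upper - lower) * F) = (1 - 2 * b * cos \<theta> * (upper - lower) * \<eta>) * F" for b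
      by (simp add: algebra_simps)
    then show ?thesis by this
  qed
  finally show ?thesis by (simp add: d d' F_def sum_nonneg)
qed

end

theorem theorem12:
  fixes A :: "real^'n^'n"
    and lam :: "nat \<Rightarrow> real" and v :: "nat \<Rightarrow> real^'n"
    and n k :: nat
    and \<delta> \<gamma> \<eta> c\<^sub>Q :: real and \<eta>s :: "nat \<Rightarrow> real"
    and V :: "(real^'n) set"
    and S :: "nat \<Rightarrow> (real^'n) set"
  assumes n: "n = CARD('n)" and k: "k = CARD('k::finite)"
    and k_range: "1 \<le> k" "k \<le> n - 1"
    and A_sym: "transpose A = A"
    and A_psd: "\<forall>x. 0 \<le> x \<bullet> (A *v x)"
    and eigen: "\<forall>i\<in>{1..n}. A *v v i = lam i *\<^sub>R v i"
    and orthonormal: "\<forall>i\<in>{1..n}. \<forall>j\<in>{1..n}. v i \<bullet> v j = (if i = j then 1 else 0)"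
    and ordered: "\<forall>i\<in>{1..n}. \<forall>j\<in>{1..n}. i \<le> j \<longrightarrow> lam j \<le> lam i"
    and delta: "\<delta> = lam k - lam (k + 1)"
    and gamma: "\<gamma> = 2 * (lam 1 - lam n)"
    and V: "V = span (v ` {1..k})"
    and c_Q: "c\<^sub>Q = 4 / pi\<^sup>2"
    and S0: "S 0 \<in> Gr TYPE('k)"
    and S0_dist: "gr_dist TYPE('k) (S 0) V < pi / 2"
    and eta_pos: "0 < \<eta>"
    and step_lower: "\<forall>t. \<eta> \<le> \<eta>s t"
    and step_upper: "\<forall>t. \<gamma> \<noteq> 0 \<longrightarrow> \<eta>s t \<le> cos (gr_dist TYPE('k) (S 0) V) / \<gamma>"
    and descent: "\<forall>t. \<exists>X :: real^'k^'n. represents X (S t) \<and>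
      S (Suc t) = gr_exp X (- \<eta>s t *\<^sub>R rgrad A X)"
  shows "\<forall>t. (gr_dist TYPE('k) (S t) V)\<^sup>2
    \<le> (1 - 2 * c\<^sub>Q * cos (gr_dist TYPE('k) (S 0) V) * \<delta> * \<eta>) ^ t * (gr_dist TYPE('k) (S 0) V)\<^sup>2"
proof -
  define d where "d t = gr_dist TYPE('k) (S t) V" for t
  have n_pos: "1 \<le> n" "k + 1 \<le> n" using k_range by auto
  have "card (UNIV :: 'n set) = card {1..n}" using n by simp
  then have "\<exists>h. bij_betw h (UNIV :: 'n set) {1..n}" by (intro finite_same_card_bij) simp_all
  then obtain h :: "'n \<Rightarrow> nat" where h: "bij_betw h UNIV {1..n}" by blast
  have hr: "h i \<in> {1..n}" for i using h by (auto simp: bij_betw_def)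
  define w \<mu> K where "w i = v (h i)" and "\<mu> i = lam (h i)" and "K = {i. h i \<le> k}" for i
  have lam: "lam j \<le> lam i" if "1 \<le> i" "i \<le> j" "j \<le> n" for i j using ordered that by auto
  interpret eigenbasis: split_eigenbasis A w \<mu> K "lam 1" "lam k" "lam (k + 1)" "lam n"
  proof
    show "transpose A = A" by (rule A_sym)
    show "w i \<bullet> w j = (if i = j then 1 else 0)" for i j
      using orthonormal hr[of i] hr[of j] h unfolding w_def by (simp add: bij_betw_def inj_eq)
    show "A *v w i = \<mu> i *\<^sub>R w i" for i using eigen hr[of i] by (simp add: w_def \<mu>_def)
    show "i \<in> K \<Longrightarrow> lam k \<le> \<mu> i" "i \<in> K \<Longrightarrow> \<mu> i \<le> lam 1" for i
      using hr[of i] n_pos k_range by (auto simp: K_def \<mu>_def intro!: lam)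
    show "i \<notin> K \<Longrightarrow> lam n \<le> \<mu> i" "i \<notin> K \<Longrightarrow> \<mu> i \<le> lam (k + 1)" for i
      using hr[of i] n_pos k_range by (auto simp: K_def \<mu>_def intro!: lam)
    show "lam n \<le> lam (k + 1)" "lam (k + 1) \<le> lam k" "lam k \<le> lam 1"
      using n_pos k_range by (auto intro!: lam)
  qed
  have V_w: "V = span (w ` K)"
  proof -
    have "h ` K = {1..k}"
    proof
      show "h ` K \<subseteq> {1..k}" using hr by (auto simp: K_def)
      show "{1..k} \<subseteq> h ` K"
      proof
        fix m assume m: "m \<in> {1..k}"
        then have "m \<in> h ` UNIV" using h n_pos by (auto simp: bij_betw_def)
        then show "m \<in> h ` K" using m by (auto simp: K_def)
      qed
    qed
    then have "w ` K = v ` {1..k}" by (metis (no_types, lifting) image_cong image_image w_def)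
    then show ?thesis by (simp add: V)
  qed
  have rep_V: "\<exists>Y :: real^'k^'n. represents Y V"
  proof -
    have "v i \<bullet> v j = (if i = j then 1 else 0)" if "i \<in> {1..k}" "j \<in> {1..k}" for i j
      using orthonormal that n_pos by auto
    then show ?thesis
      using represents_span_of_orthonormal[of "{1..k}" v, where 'k = 'k] k unfolding V by fastforce
  qed
  have rep_S: "\<exists>X :: real^'k^'n. represents X (S t)" for t using descent by blast
  have d0: "0 \<le> d t" for t unfolding d_def by (rule gr_dist_nonneg[OF rep_S rep_V])
  define c where "c = cos (d 0)"
  have d_range: "0 \<le> d 0" "d 0 \<le> pi/2" using d0 S0_dist by (auto simp: d_def)
  have c: "0 \<le> c" "c \<le> 1" using cos_in_unit[OF d_range] by (auto simp: c_def)
  have gaps: "0 \<le> \<delta>" "2 * \<delta> \<le> \<gamma>" using eigenbasis.ordered_bounds by (auto simp: delta gamma)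
  have step_small: "\<gamma> * \<eta>s t \<le> c" for t
  proof (cases "\<gamma> = 0")
    case False
    then have "\<gamma> > 0" using gaps by simp
    then show ?thesis using step_upper False by (simp add: c_def d_def field_simps)
  qed (use c in simp)
  have eta: "0 \<le> \<eta>s t" "\<eta> \<le> \<eta>s t" for t using step_lower eta_pos by (auto intro: order_trans[of _ \<eta>])
  define q where "q = 1 - 2 * c\<^sub>Q * c * \<delta> * \<eta>"
  have cQ: "0 \<le> c\<^sub>Q" "c\<^sub>Q \<le> 1"
  proof -
    show "0 \<le> c\<^sub>Q" by (simp add: c_Q)
    have "2\<^sup>2 \<le> pi\<^sup>2" using pi_ge_two by (intro power_mono) auto
    then show "c\<^sub>Q \<le> 1" by (simp add: c_Q)
  qed
  \<comment> \<open>Nonnegativity of the rate is needed to iterate the contraction.\<close>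
  have q: "0 \<le> q" "q \<le> 1"
  proof -
    have "2 * \<delta> * \<eta> \<le> \<gamma> * \<eta>s 0" using gaps eta[of 0] eta_pos by (intro mult_mono) auto
    then have "2 * \<delta> * \<eta> \<le> 1" using step_small[of 0] c by simp
    moreover have "c\<^sub>Q * c \<le> 1" using cQ c by (intro mult_le_one)
    ultimately have "(c\<^sub>Q * c) * (2 * \<delta> * \<eta>) \<le> 1 * 1"
      using gaps eta_pos by (intro mult_mono) auto
    then show "0 \<le> q" by (simp add: q_def mult_ac)
    show "q \<le> 1" using cQ c gaps eta_pos by (simp add: q_def)
  qed
  have contract: "(d (Suc t))\<^sup>2 \<le> q * (d t)\<^sup>2" if le: "d t \<le> d 0" for t
  proof -
    obtain X :: "real^'k^'n" where X: "represents X (S t)" "S (Suc t) = gr_exp X (- \<eta>s t *\<^sub>R rgrad A X)"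
      using descent by blast
    have "(d (Suc t))\<^sup>2 \<le> (1 - 2 * (4 / pi\<^sup>2) * cos (d 0) * (lam k - lam (k + 1)) * \<eta>s t) * (d t)\<^sup>2"
      unfolding d_def
    proof (rule eigenbasis.squared_distance_contracts[OF X(1) V_w rep_V _ _ _ _ eta(1) _ X(2)])
      show "CARD('k) \<le> CARD('n)" using n k n_pos by simp
      show "2 * (lam 1 - lam n) * \<eta>s t \<le> cos (gr_dist TYPE('k) (S 0) V)"
        using step_small[of t] by (simp add: gamma c_def d_def)
    qed (use le d_range in \<open>auto simp: d_def\<close>)
    also have "\<dots> \<le> q * (d t)\<^sup>2"
    proof (rule mult_right_mono)
      have "2 * c\<^sub>Q * c * \<delta> * \<eta> \<le> 2 * c\<^sub>Q * c * \<delta> * \<eta>s t"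
        using cQ c gaps eta by (intro mult_left_mono mult_nonneg_nonneg) auto
      then show "1 - 2 * (4 / pi\<^sup>2) * cos (d 0) * (lam k - lam (k + 1)) * \<eta>s t \<le> q"
        by (simp add: q_def c_Q c_def delta)
    qed simp
    finally show ?thesis .
  qed
  have "(d t)\<^sup>2 \<le> q ^ t * (d 0)\<^sup>2 \<and> d t \<le> d 0" for t
  proof (induction t)
    case (Suc t)
    then have IH: "(d t)\<^sup>2 \<le> q ^ t * (d 0)\<^sup>2" and le: "d t \<le> d 0" by auto
    have "(d (Suc t))\<^sup>2 \<le> 1 * (d t)\<^sup>2"
      by (rule order_trans[OF contract[OF le] mult_right_mono[OF q(2)]]) simp
    then have "d (Suc t) \<le> d t" using power2_le_imp_le[OF _ d0[of t]] by simp
    moreover have "q * (d t)\<^sup>2 \<le> q * (q ^ t * (d 0)\<^sup>2)" using IH q by (intro mult_left_mono)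
    ultimately show ?case using contract[OF le] le by (auto simp: mult.assoc)
  qed simp
  then show ?thesis by (simp add: d_def q_def c_def)
qed

end
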